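(* (i) Let $M_\infty$ be the group of matrices indexed by $\mathbb{Z}\times\mathbb{Z}$, with integer entries, generated by the elementary matrices $m_i$, $i\in\mathbb{Z}$, where $m_i$ has all diagonal entries equal to $1$, the entry at $(i,i+1)$ equal to $1$, and all other entries equal to $0$. Let $G=M_\infty\rtimes\langle\phi\rangle$ be the extension of $M_\infty$ by the infinite cyclic group generated by $\phi$, where $\phi$ acts by the shift $(z_1,z_2)\mapsto(z_1+1,z_2+1)$ of indices, i.e. $\phi m_i\phi^{-1}=m_{i+1}$. Let $\bar w(x_1,x_2,x_3)=[x_1,[x_2,x_3]]$. Then $G$ satisfies the iterated identity $\bar w$, and for every non-trivial iterated identity $w$ of $G$ one has $s(w,G)=\infty$. In particular, $G$ is fractal with respect to identities. (ii) Moreover, there exists a continuum of pairwise non-isomorphic finitely generated elementary amenable groups that are fractal with respect to identities and that do not satisfy any non-trivial identity.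
   Context: Notation: $[u,v]=u^{-1}v^{-1}uv$. Let $w=w(x_1,\dots,x_n)$ be a word (element of the free group $F_n$ on $x_1,\dots,x_n$, $n\ge 1$). Its Engel type iterations on the first variable are $w_{\circ 1}=w$ and $w_{\circ (N+1)}(x_1,\dots,x_n)=w(w_{\circ N}(x_1,\dots,x_n),x_2,\dots,x_n)$ for $N\ge 1$. A group $G$ satisfies the ($E$-type) iterated identity $w$ if for all $x_1,\dots,x_n\in G$ there exists $N\ge 1$ with $w_{\circ N}(x_1,\dots,x_n)=e$ in $G$. A group $G$ satisfies the identity $w$ if $w(x_1,\dots,x_n)=e$ for all $x_1,\dots,x_n\in G$. If $w$ is an iterated identity of $G$, the iterational depth $s(w,G)$ of $w$ in $G$ is the infimum (possibly $+\infty$) of those integers $D\ge 1$ such that for all $x_1,\dots,x_n\in G$ there is $1\le d\le D$ with $w_{\circ d}(x_1,\dots,x_n)=e$. A word is non-trivial if it is not equal to the identity in the free group. The iterational depth of $G$ is $s(G)=\sup_w s(w,G)$, the supremum over all non-trivial iterated identities $w$ satisfied by $G$; if there are none, $s(G)=-\infty$. $G$ is called fractal with respect to identities if $s(G)=+\infty$. *)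

theory Defs
  imports
    "HOL-Algebra.Algebra"
    "HOL-Library.Extended_Real"
    "HOL-Library.Equipollence"
begin

section \<open>Words\<close>

text \<open>The letter \<open>(i, True)\<close> is $x_i$ and \<open>(i, False)\<close> is $x_i^{-1}$.\<close>

type_synonym letter = "nat \<times> bool"

definition inv_letter :: "letter \<Rightarrow> letter"
  where "inv_letter a = (fst a, \<not> snd a)"

definition reduced :: "letter list \<Rightarrow> bool"
  where "reduced = successively (\<lambda>a b. b \<noteq> inv_letter a)"

definition push :: "letter \<Rightarrow> letter list \<Rightarrow> letter list"
  where "push a w = (case w of [] \<Rightarrow> [a] | b # v \<Rightarrow> if b = inv_letter a then v else a # w)"

text \<open>The free group on $x_1,\dots,x_n$: reduced words, multiplied by concatenation followed by
  free reduction.\<close>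

definition free_group :: "nat \<Rightarrow> letter list monoid"
  where "free_group n =
    \<lparr>carrier = {w. reduced w \<and> fst ` set w \<subseteq> {1..n}}, monoid.mult = foldr push, one = []\<rparr>"

definition gen :: "nat \<Rightarrow> letter list"
  where "gen i = [(i, True)]"

primrec word_eval :: "('a, 'b) monoid_scheme \<Rightarrow> (nat \<Rightarrow> 'a) \<Rightarrow> letter list \<Rightarrow> 'a"
  where
    "word_eval G x [] = \<one>\<^bsub>G\<^esub>"
  | "word_eval G x (a # w) =
      (if snd a then x (fst a) else inv\<^bsub>G\<^esub> x (fst a)) \<otimes>\<^bsub>G\<^esub> word_eval G x w"

text \<open>The convention is $[u,v] = u^{-1}v^{-1}uv$.\<close>

definition commutator :: "('a, 'b) monoid_scheme \<Rightarrow> 'a \<Rightarrow> 'a \<Rightarrow> 'a"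
  where "commutator G u v = inv\<^bsub>G\<^esub> u \<otimes>\<^bsub>G\<^esub> inv\<^bsub>G\<^esub> v \<otimes>\<^bsub>G\<^esub> u \<otimes>\<^bsub>G\<^esub> v"

lemma inv_letter_inv_letter [simp]: "inv_letter (inv_letter a) = a"
  by (simp add: inv_letter_def)

lemma reduced_push: "reduced w \<Longrightarrow> reduced (push a w)"
  by (cases w) (auto simp: reduced_def push_def successively_Cons)

lemma reduced_foldr_push: "reduced w \<Longrightarrow> reduced (foldr push u w)"
  by (induction u) (auto simp: reduced_push)

lemma push_push_inv: "reduced w \<Longrightarrow> push a (push (inv_letter a) w) = w"
  by (cases w; cases "tl w") (auto simp: reduced_def push_def successively_Cons)

lemma foldr_push_reduced: "reduced u \<Longrightarrow> foldr push u [] = u"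
proof (induction u)
  case (Cons a u)
  then have "reduced u" by (cases u) (auto simp: reduced_def)
  then show ?case using Cons by (cases u) (auto simp: reduced_def push_def)
qed simp

lemma foldr_push_push:
  assumes "reduced w"
  shows "foldr push (push a u) w = push a (foldr push u w)"
proof (cases u)
  case (Cons b v)
  then show ?thesis
    using push_push_inv[OF reduced_foldr_push[OF assms, of v], of a]
    by (auto simp: push_def[of a "b # v"])
qed (simp add: push_def)

lemma foldr_push_assoc:
  "reduced w \<Longrightarrow> foldr push (foldr push u v) w = foldr push u (foldr push v w)"
  by (induction u) (auto simp: foldr_push_push)

lemma foldr_push_inverse:
  "reduced u \<Longrightarrow> foldr push (rev (map inv_letter u)) u = []"
proof (induction u)
  case (Cons a u)
  then have "reduced u" by (cases u) (auto simp: reduced_def)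
  then show ?case using Cons by (simp add: push_def)
qed simp

lemma letters_foldr_push: "fst ` set (foldr push u v) \<subseteq> fst ` set u \<union> fst ` set v"
proof (induction u)
  case (Cons a u)
  have "set (push a w) \<subseteq> insert a (set w)" for w
    by (auto simp: push_def split: list.splits if_splits)
  from this[of "foldr push u v"] Cons show ?case by auto
qed simp

lemma group_free_group: "group (free_group n)"
proof -
  have carr: "u \<in> carrier (free_group n) \<longleftrightarrow> reduced u \<and> fst ` set u \<subseteq> {1..n}" for u
    by (simp add: free_group_def)
  have mult: "u \<otimes>\<^bsub>free_group n\<^esub> v = foldr push u v" for u v
    by (simp add: free_group_def)
  have one: "\<one>\<^bsub>free_group n\<^esub> = []" and Nil: "reduced []"
    by (simp_all add: free_group_def reduced_def)
  show ?thesis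
  proof (rule groupI, unfold carr mult one)
    fix u v :: "letter list"
    assume "reduced u \<and> fst ` set u \<subseteq> {1..n}" "reduced v \<and> fst ` set v \<subseteq> {1..n}"
    then show "reduced (foldr push u v) \<and> fst ` set (foldr push u v) \<subseteq> {1..n}"
      using letters_foldr_push[of u v] reduced_foldr_push by (meson Un_least order_trans)
  next
    fix u assume u: "reduced u \<and> fst ` set u \<subseteq> {1..n}"
    define y where "y = foldr push (rev (map inv_letter u)) []"
    have "fst ` set (rev (map inv_letter u)) = fst ` set u"
      by (simp add: image_image inv_letter_def)
    then have "fst ` set y \<subseteq> fst ` set u"
      using letters_foldr_push[of "rev (map inv_letter u)" "[]"] unfolding y_def by simp
    then have "fst ` set y \<subseteq> {1..n}" using u by (blast intro: order_trans)
    moreover have "reduced y" unfolding y_def using Nil by (rule reduced_foldr_push)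
    moreover have "foldr push y u = []"
      using u by (simp add: y_def foldr_push_assoc foldr_push_inverse)
    ultimately show "\<exists>y\<in>carrier (free_group n). foldr push y u = []"
      by (auto simp: carr)
  qed (simp_all add: Nil foldr_push_assoc)
qed


section \<open>Iterated identities and iterational depth\<close>

text \<open>\<open>engel_iter n w N\<close> is $w_{\circ N}$ for $N \ge 1$; substituting words for the variables is
  evaluation in the free group. The value at \<open>N = 0\<close> is never used.\<close>

fun engel_iter :: "nat \<Rightarrow> letter list \<Rightarrow> nat \<Rightarrow> letter list"
  where
    "engel_iter n w 0 = gen 1"
  | "engel_iter n w (Suc 0) = w"
  | "engel_iter n w (Suc (Suc N)) =
      word_eval (free_group n) (gen(1 := engel_iter n w (Suc N))) w"

definition satisfies_identity :: "('a, 'b) monoid_scheme \<Rightarrow> nat \<Rightarrow> letter list \<Rightarrow> bool"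
  where "satisfies_identity G n w \<longleftrightarrow> (\<forall>x \<in> {1..n} \<rightarrow> carrier G. word_eval G x w = \<one>\<^bsub>G\<^esub>)"

definition satisfies_iterated_identity :: "('a, 'b) monoid_scheme \<Rightarrow> nat \<Rightarrow> letter list \<Rightarrow> bool"
  where "satisfies_iterated_identity G n w \<longleftrightarrow>
    (\<forall>x \<in> {1..n} \<rightarrow> carrier G. \<exists>N\<ge>1. word_eval G x (engel_iter n w N) = \<one>\<^bsub>G\<^esub>)"

definition word_depth :: "('a, 'b) monoid_scheme \<Rightarrow> nat \<Rightarrow> letter list \<Rightarrow> ereal"
  where "word_depth G n w =
    (INF D \<in> {D. 1 \<le> D \<and> (\<forall>x \<in> {1..n} \<rightarrow> carrier G.
        \<exists>d. 1 \<le> d \<and> d \<le> D \<and> word_eval G x (engel_iter n w d) = \<one>\<^bsub>G\<^esub>)}. ereal (real D))"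

text \<open>In \<^typ>\<open>ereal\<close> the infimum of the empty set is \<open>\<infinity>\<close> and its supremum is \<open>-\<infinity>\<close>.\<close>

definition group_depth :: "('a, 'b) monoid_scheme \<Rightarrow> ereal"
  where "group_depth G =
    Sup {word_depth G n w | n w. 1 \<le> n \<and> w \<in> carrier (free_group n) \<and>
      w \<noteq> \<one>\<^bsub>free_group n\<^esub> \<and> satisfies_iterated_identity G n w}"

definition fractal :: "('a, 'b) monoid_scheme \<Rightarrow> bool"
  where "fractal G \<longleftrightarrow> group_depth G = \<infinity>"

definition w_bar :: "letter list"
  where "w_bar = commutator (free_group 3) (gen 1) (commutator (free_group 3) (gen 2) (gen 3))"


section \<open>The group of infinite matrices and its extension by the shift\<close>

type_synonym int_matrix = "int \<Rightarrow> int \<Rightarrow> int"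

text \<open>Row- and column-finite matrices, so that all products are given by finite sums.\<close>

definition matrices :: "int_matrix monoid"
  where "matrices =
    \<lparr>carrier = {A. (\<forall>i. finite {j. A i j \<noteq> 0}) \<and> (\<forall>j. finite {i. A i j \<noteq> 0})},
     monoid.mult = (\<lambda>A B i j. \<Sum>k | A i k \<noteq> 0. A i k * B k j),
     one = (\<lambda>i j. if i = j then 1 else 0)\<rparr>"

definition elem_matrix :: "int \<Rightarrow> int_matrix"
  where "elem_matrix i = (\<lambda>a b. if a = b \<or> (a = i \<and> b = i + 1) then 1 else 0)"

definition M_inf :: "int_matrix monoid"
  where "M_inf = subgroup_generated (units_of matrices) (range elem_matrix)"

definition shift :: "int \<Rightarrow> int_matrix \<Rightarrow> int_matrix"
  where "shift k A = (\<lambda>i j. A (i - k) (j - k))"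

definition semidirect_product ::
    "('a, 'c) monoid_scheme \<Rightarrow> ('b, 'd) monoid_scheme \<Rightarrow> ('b \<Rightarrow> 'a \<Rightarrow> 'a) \<Rightarrow> ('a \<times> 'b) monoid"
  where "semidirect_product N H \<theta> =
    \<lparr>carrier = carrier N \<times> carrier H,
     monoid.mult = (\<lambda>(a, h) (b, k). (a \<otimes>\<^bsub>N\<^esub> \<theta> h b, h \<otimes>\<^bsub>H\<^esub> k)),
     one = (\<one>\<^bsub>N\<^esub>, \<one>\<^bsub>H\<^esub>)\<rparr>"

text \<open>The element $\phi$ is \<open>(\<one>, 1)\<close>.\<close>

definition G_inf :: "(int_matrix \<times> int) monoid"
  where "G_inf = semidirect_product M_inf integer_group shift"

lemma shift_elem_matrix: "shift k (elem_matrix i) = elem_matrix (i + k)"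
  by (auto simp: shift_def elem_matrix_def fun_eq_iff)

lemma matrices_mult_superset:
  assumes "finite S" "{k. A i k \<noteq> 0} \<subseteq> S"
  shows "(A \<otimes>\<^bsub>matrices\<^esub> B) i j = (\<Sum>k\<in>S. A i k * B k j)"
  unfolding matrices_def using assms by (auto intro: sum.mono_neutral_left)

lemma monoid_matrices: "monoid matrices"
proof (rule monoidI)
  fix A B assume A: "A \<in> carrier matrices" and B: "B \<in> carrier matrices"
  have AB: "(A \<otimes>\<^bsub>matrices\<^esub> B) i j = (\<Sum>k | A i k \<noteq> 0. A i k * B k j)" for i j
    by (simp add: matrices_def)
  have "{j. (A \<otimes>\<^bsub>matrices\<^esub> B) i j \<noteq> 0} \<subseteq> (\<Union>k\<in>{k. A i k \<noteq> 0}. {j. B k j \<noteq> 0})" for i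
    by (auto simp: AB elim!: sum.not_neutral_contains_not_neutral)
  moreover have "finite (\<Union>k\<in>{k. A i k \<noteq> 0}. {j. B k j \<noteq> 0})" for i
    using A B by (simp add: matrices_def)
  ultimately have row: "finite {j. (A \<otimes>\<^bsub>matrices\<^esub> B) i j \<noteq> 0}" for i
    by (rule finite_subset)
  have "{i. (A \<otimes>\<^bsub>matrices\<^esub> B) i j \<noteq> 0} \<subseteq> (\<Union>k\<in>{k. B k j \<noteq> 0}. {i. A i k \<noteq> 0})" for j
    by (auto simp: AB elim!: sum.not_neutral_contains_not_neutral)
  moreover have "finite (\<Union>k\<in>{k. B k j \<noteq> 0}. {i. A i k \<noteq> 0})" for j
    using A B by (simp add: matrices_def)
  ultimately have "finite {i. (A \<otimes>\<^bsub>matrices\<^esub> B) i j \<noteq> 0}" for j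
    by (rule finite_subset)
  with row have "A \<otimes>\<^bsub>matrices\<^esub> B \<in> {A. (\<forall>i. finite {j. A i j \<noteq> 0}) \<and> (\<forall>j. finite {i. A i j \<noteq> 0})}"
    by simp
  then show "A \<otimes>\<^bsub>matrices\<^esub> B \<in> carrier matrices"
    by (simp add: matrices_def)
next
  fix A B C
  assume A: "A \<in> carrier matrices" and B: "B \<in> carrier matrices" and C: "C \<in> carrier matrices"
  show "A \<otimes>\<^bsub>matrices\<^esub> B \<otimes>\<^bsub>matrices\<^esub> C = A \<otimes>\<^bsub>matrices\<^esub> (B \<otimes>\<^bsub>matrices\<^esub> C)"
  proof (intro ext)
    fix i j
    let ?K = "{k. A i k \<noteq> 0}"
    let ?L = "\<Union>k\<in>?K. {l. B k l \<noteq> 0}"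
    have fK: "finite ?K" and fL: "finite ?L" using A B by (auto simp: matrices_def)
    have AX: "(A \<otimes>\<^bsub>matrices\<^esub> D) i l = (\<Sum>k\<in>?K. A i k * D k l)" for D l
      by (simp add: matrices_def)
    have "(A \<otimes>\<^bsub>matrices\<^esub> B \<otimes>\<^bsub>matrices\<^esub> C) i j = (\<Sum>l\<in>?L. (A \<otimes>\<^bsub>matrices\<^esub> B) i l * C l j)"
      by (rule matrices_mult_superset[OF fL])
        (auto simp: AX elim!: sum.not_neutral_contains_not_neutral)
    also have "\<dots> = (\<Sum>l\<in>?L. \<Sum>k\<in>?K. A i k * (B k l * C l j))"
      by (simp only: AX sum_distrib_right mult.assoc)
    also have "\<dots> = (\<Sum>k\<in>?K. A i k * (\<Sum>l\<in>?L. B k l * C l j))"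
      by (subst sum.swap) (simp only: sum_distrib_left)
    also have "\<dots> = (\<Sum>k\<in>?K. A i k * (B \<otimes>\<^bsub>matrices\<^esub> C) k j)"
    proof (rule sum.cong[OF refl])
      fix k assume "k \<in> ?K"
      then have "{l. B k l \<noteq> 0} \<subseteq> ?L" by blast
      then show "A i k * (\<Sum>l\<in>?L. B k l * C l j) = A i k * (B \<otimes>\<^bsub>matrices\<^esub> C) k j"
        by (simp add: matrices_mult_superset[OF fL])
    qed
    finally show "(A \<otimes>\<^bsub>matrices\<^esub> B \<otimes>\<^bsub>matrices\<^esub> C) i j = (A \<otimes>\<^bsub>matrices\<^esub> (B \<otimes>\<^bsub>matrices\<^esub> C)) i j"
      by (simp only: AX)
  qed
next
  fix A assume "A \<in> carrier matrices"
  then have fin: "finite {k. A i k \<noteq> 0}" for i by (simp add: matrices_def)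
  show "A \<otimes>\<^bsub>matrices\<^esub> \<one>\<^bsub>matrices\<^esub> = A"
  proof (intro ext)
    fix i j
    have "(A \<otimes>\<^bsub>matrices\<^esub> \<one>\<^bsub>matrices\<^esub>) i j = (\<Sum>k | A i k \<noteq> 0. if k = j then A i k else 0)"
      unfolding matrices_def by (simp, intro sum.cong) auto
    then show "(A \<otimes>\<^bsub>matrices\<^esub> \<one>\<^bsub>matrices\<^esub>) i j = A i j" using fin by simp
  qed
next
  fix A
  show "\<one>\<^bsub>matrices\<^esub> \<otimes>\<^bsub>matrices\<^esub> A = A"
    by (simp add: matrices_def fun_eq_iff)
qed (simp add: matrices_def)

lemma elem_matrix_Units: "elem_matrix i \<in> Units matrices"
proof -
  define E where "E c = (\<lambda>a b. if a = b then 1 else if a = i \<and> b = i + 1 then c else (0::int))"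
    for c
  have carr: "E c \<in> carrier matrices" for c
  proof -
    have "{b. E c a b \<noteq> 0} \<subseteq> {a, i + 1}" "{b. E c b a \<noteq> 0} \<subseteq> {a, i}" for a
      by (auto simp: E_def)
    then have "finite {b. E c a b \<noteq> 0}" "finite {b. E c b a \<noteq> 0}" for a
      by (meson finite.emptyI finite.insertI finite_subset)+
    then show ?thesis by (simp add: matrices_def)
  qed
  have mult: "E c \<otimes>\<^bsub>matrices\<^esub> E d = E (c + d)" for c d
  proof (intro ext)
    fix a b
    show "(E c \<otimes>\<^bsub>matrices\<^esub> E d) a b = E (c + d) a b"
      by (subst matrices_mult_superset[of "{a, i + 1}"]; cases "a = i + 1") (auto simp: E_def)
  qed
  have E0: "E 0 = \<one>\<^bsub>matrices\<^esub>" and E1: "E 1 = elem_matrix i"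
    by (auto simp: E_def matrices_def elem_matrix_def fun_eq_iff)
  have "E (-1) \<otimes>\<^bsub>matrices\<^esub> E 1 = \<one>\<^bsub>matrices\<^esub>"
    and "E 1 \<otimes>\<^bsub>matrices\<^esub> E (-1) = \<one>\<^bsub>matrices\<^esub>"
    by (simp_all add: mult E0)
  then have "E 1 \<in> Units matrices"
    using carr unfolding Units_def by blast
  then show ?thesis by (simp only: E1)
qed

lemma group_M_inf: "group M_inf"
  unfolding M_inf_def
  by (intro group.group_subgroup_generated monoid.units_group monoid_matrices)

lemma shift_mult: "shift k (A \<otimes>\<^bsub>matrices\<^esub> B) = shift k A \<otimes>\<^bsub>matrices\<^esub> shift k B"
proof (intro ext)
  fix i j
  show "shift k (A \<otimes>\<^bsub>matrices\<^esub> B) i j = (shift k A \<otimes>\<^bsub>matrices\<^esub> shift k B) i j"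
    unfolding shift_def matrices_def
    by (auto intro!: sum.reindex_bij_witness[of _ "\<lambda>l. l - k" "\<lambda>l. l + k"])
qed

lemma shift_hom: "shift k \<in> hom (units_of matrices) (units_of matrices)"
proof -
  have carr: "shift k A \<in> carrier matrices" if "A \<in> carrier matrices" for A
  proof -
    have shift_set: "{j. P (j - k)} = (\<lambda>j. j + k) ` {j. P j}" for P
    proof (intro Set.set_eqI iffI)
      fix j assume "j \<in> {j. P (j - k)}"
      then show "j \<in> (\<lambda>j. j + k) ` {j. P j}" by (intro image_eqI[of _ _ "j - k"]) auto
    qed auto
    have "{j. A i (j - k) \<noteq> 0} = (\<lambda>j. j + k) ` {j. A i j \<noteq> 0}"
      and "{i. A (i - k) j \<noteq> 0} = (\<lambda>i. i + k) ` {i. A i j \<noteq> 0}" for i j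
      by (rule shift_set)+
    then show ?thesis using that by (auto simp: matrices_def shift_def)
  qed
  have one: "shift k \<one>\<^bsub>matrices\<^esub> = \<one>\<^bsub>matrices\<^esub>"
    by (simp add: shift_def matrices_def fun_eq_iff)
  have "shift k A \<in> Units matrices" if "A \<in> Units matrices" for A
  proof -
    from that obtain B where "A \<in> carrier matrices" "B \<in> carrier matrices"
      "B \<otimes>\<^bsub>matrices\<^esub> A = \<one>\<^bsub>matrices\<^esub>" "A \<otimes>\<^bsub>matrices\<^esub> B = \<one>\<^bsub>matrices\<^esub>"
      unfolding Units_def by blast
    then have "shift k A \<in> carrier matrices" "shift k B \<in> carrier matrices"
      "shift k B \<otimes>\<^bsub>matrices\<^esub> shift k A = \<one>\<^bsub>matrices\<^esub>"
      "shift k A \<otimes>\<^bsub>matrices\<^esub> shift k B = \<one>\<^bsub>matrices\<^esub>"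
      using carr one by (simp_all flip: shift_mult)
    then show ?thesis unfolding Units_def by blast
  qed
  then show ?thesis by (auto simp: hom_def units_of_def shift_mult)
qed

lemma shift_M_inf: "shift k \<in> hom M_inf M_inf"
proof -
  let ?U = "units_of matrices"
  have U: "group ?U" by (intro monoid.units_group monoid_matrices)
  have sub: "range elem_matrix \<subseteq> carrier ?U"
    by (auto simp: units_of_def elem_matrix_Units)
  then have carr: "carrier M_inf = generate ?U (range elem_matrix)"
    by (simp add: M_inf_def carrier_subgroup_generated Int_absorb1)
  interpret group_hom ?U ?U "shift k"
    using U shift_hom by (simp add: group_hom_def group_hom_axioms_def)
  have "elem_matrix i \<in> shift k ` range elem_matrix" for i
    by (rule image_eqI[of _ _ "elem_matrix (i - k)"]) (simp_all add: shift_elem_matrix)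
  then have "range elem_matrix \<subseteq> shift k ` range elem_matrix"
    by (rule image_subsetI)
  moreover have "shift k ` range elem_matrix \<subseteq> range elem_matrix"
    by (auto simp: shift_elem_matrix)
  ultimately have "shift k ` range elem_matrix = range elem_matrix"
    by (rule subset_antisym[rotated])
  then have "shift k ` carrier M_inf = carrier M_inf"
    using generate_img[OF sub] by (simp only: carr)
  then have "shift k A \<in> carrier M_inf" if "A \<in> carrier M_inf" for A
    using imageI[OF that, of "shift k"] by (simp only:)
  moreover have "shift k (A \<otimes>\<^bsub>M_inf\<^esub> B) = shift k A \<otimes>\<^bsub>M_inf\<^esub> shift k B" for A B
    by (simp add: M_inf_def units_of_mult shift_mult)
  ultimately show ?thesis by (intro homI)
qed

lemma group_semidirect_product:
  assumes "group N" "group H"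
    and hom: "\<And>h. h \<in> carrier H \<Longrightarrow> \<theta> h \<in> hom N N"
    and comp: "\<And>h k a. h \<in> carrier H \<Longrightarrow> k \<in> carrier H \<Longrightarrow> a \<in> carrier N \<Longrightarrow>
      \<theta> (h \<otimes>\<^bsub>H\<^esub> k) a = \<theta> h (\<theta> k a)"
    and one: "\<And>a. a \<in> carrier N \<Longrightarrow> \<theta> \<one>\<^bsub>H\<^esub> a = a"
  shows "group (semidirect_product N H \<theta>)"
proof -
  interpret N: group N by fact
  interpret H: group H by fact
  have carr: "\<theta> h a \<in> carrier N" if "h \<in> carrier H" "a \<in> carrier N" for h a
    using hom[OF that(1)] that(2) by (auto simp: hom_def)
  have mult: "\<theta> h (a \<otimes>\<^bsub>N\<^esub> b) = \<theta> h a \<otimes>\<^bsub>N\<^esub> \<theta> h b"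
    if "h \<in> carrier H" "a \<in> carrier N" "b \<in> carrier N" for h a b
    using hom[OF that(1)] that(2,3) by (auto simp: hom_def)
  show ?thesis
  proof (rule groupI)
    fix p assume "p \<in> carrier (semidirect_product N H \<theta>)"
    then obtain a h where p: "p = (a, h)" "a \<in> carrier N" "h \<in> carrier H"
      by (auto simp: semidirect_product_def)
    let ?q = "(\<theta> (inv\<^bsub>H\<^esub> h) (inv\<^bsub>N\<^esub> a), inv\<^bsub>H\<^esub> h)"
    have "\<theta> (inv\<^bsub>H\<^esub> h) \<one>\<^bsub>N\<^esub> = \<one>\<^bsub>N\<^esub>"
      using hom_one[OF hom assms(1,1)] p by simp
    then have "\<theta> (inv\<^bsub>H\<^esub> h) (inv\<^bsub>N\<^esub> a) \<otimes>\<^bsub>N\<^esub> \<theta> (inv\<^bsub>H\<^esub> h) a = \<one>\<^bsub>N\<^esub>"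
      using mult[of "inv\<^bsub>H\<^esub> h" "inv\<^bsub>N\<^esub> a" a] p by simp
    then have "?q \<otimes>\<^bsub>semidirect_product N H \<theta>\<^esub> p = \<one>\<^bsub>semidirect_product N H \<theta>\<^esub>"
      using p by (simp add: semidirect_product_def)
    then show "\<exists>q\<in>carrier (semidirect_product N H \<theta>).
        q \<otimes>\<^bsub>semidirect_product N H \<theta>\<^esub> p = \<one>\<^bsub>semidirect_product N H \<theta>\<^esub>"
      using p by (intro bexI[of _ ?q]) (auto simp: semidirect_product_def carr)
  next
    fix p q r
    assume "p \<in> carrier (semidirect_product N H \<theta>)" "q \<in> carrier (semidirect_product N H \<theta>)"
      "r \<in> carrier (semidirect_product N H \<theta>)"
    then show "p \<otimes>\<^bsub>semidirect_product N H \<theta>\<^esub> q \<otimes>\<^bsub>semidirect_product N H \<theta>\<^esub> r =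
        p \<otimes>\<^bsub>semidirect_product N H \<theta>\<^esub> (q \<otimes>\<^bsub>semidirect_product N H \<theta>\<^esub> r)"
      by (cases p; cases q; cases r)
        (simp add: semidirect_product_def carr mult comp N.m_assoc H.m_assoc)
  qed (auto simp: semidirect_product_def carr one)
qed

lemma group_G_inf: "group G_inf"
  unfolding G_inf_def
  by (rule group_semidirect_product[OF group_M_inf group_integer_group shift_M_inf])
    (simp_all add: shift_def diff_diff_eq)


section \<open>Finitely generated and elementary amenable groups\<close>

text \<open>A finitely generated group is countable, so up to isomorphism its carrier is a subset of
  \<^typ>\<open>nat\<close>; a family of finitely generated groups can be taken in \<^typ>\<open>nat monoid\<close>.\<close>

definition finitely_generated :: "('a, 'b) monoid_scheme \<Rightarrow> bool"
  where "finitely_generated G \<longleftrightarrow> (\<exists>S. finite S \<and> S \<subseteq> carrier G \<and> generate G S = carrier G)"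

text \<open>The smallest class containing finite and abelian groups and closed under subgroups,
  quotients, extensions and directed unions. Quotients are replaced by isomorphic copies in the
  same type (which also yields closure under isomorphism). For infinite \<open>'a\<close> this restricts the
  usual class to groups of cardinality at most that of \<open>'a\<close> without losing any of them, since
  the groups from which one of them is built are again of at most this cardinality.\<close>

inductive elementary_amenable :: "'a monoid \<Rightarrow> bool"
  where
    finite_group: "group G \<Longrightarrow> finite (carrier G) \<Longrightarrow> elementary_amenable G"
  | abelian_group: "comm_group G \<Longrightarrow> elementary_amenable G"
  | subgroup: "elementary_amenable G \<Longrightarrow> subgroup H G \<Longrightarrow> elementary_amenable (G\<lparr>carrier := H\<rparr>)"
  | quotient: "elementary_amenable G \<Longrightarrow> N \<lhd> G \<Longrightarrow> group Q \<Longrightarrow> Q \<cong> G Mod N \<Longrightarrow>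
      elementary_amenable Q"
  | extension: "group G \<Longrightarrow> N \<lhd> G \<Longrightarrow> elementary_amenable (G\<lparr>carrier := N\<rparr>) \<Longrightarrow>
      elementary_amenable Q \<Longrightarrow> Q \<cong> G Mod N \<Longrightarrow> elementary_amenable G"
  | directed_union: "group G \<Longrightarrow> \<H> \<noteq> {} \<Longrightarrow>
      \<forall>H\<in>\<H>. subgroup H G \<and> elementary_amenable (G\<lparr>carrier := H\<rparr>) \<Longrightarrow>
      \<forall>H\<in>\<H>. \<forall>K\<in>\<H>. \<exists>L\<in>\<H>. H \<union> K \<subseteq> L \<Longrightarrow> \<Union>\<H> = carrier G \<Longrightarrow>
      elementary_amenable G"

end

theory Submission
  imports Defs "HOL-Analysis.Abstract_Topology_2"
begin

text \<open>Part (i). Commutators lie in the locally nilpotent subgroup $M_\infty$, which gives the iterated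
  identity. For the depth, substituting for $x_1$ a word that involves $x_1$ is an injective endomorphism
  of the free group, so all $w_{\circ d}$ are non-trivial. A reduced word with syllables
  $x_{g_1}^{e_1}, \dots, x_{g_k}^{e_k}$, evaluated at $x_i = 1 + \sum_{g_j = i} E_{j,j+1}$, has
  $e_1 \cdots e_k \neq 0$ as its entry $(1, k+1)$. Placing such blocks for $w_{\circ 1}, \dots, w_{\circ D}$ at
  disjoint positions yields one tuple in $M_\infty$ at which none of these words vanishes.

  Part (ii). For a set \<open>S\<close> of primes there is a central extension of \<open>G_inf\<close> by
  $\prod_{p \in S} \mathbb{Z}/p$ in which $[m_p, m_0]$ generates the factor $\mathbb{Z}/p$. The subgroup
  generated by lifts of $m_0$ and $\phi$ still satisfies the iterated identity and maps onto \<open>G_inf\<close>, hence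
  is fractal and satisfies no identity. Since \<open>G_inf\<close> is torsion-free, \<open>S\<close> is recovered as the set of
  prime orders of elements.\<close>

section \<open>Evaluation of words\<close>

text \<open>Since w(1, x_2, ..., x_n) may be non-trivial, an iterate can vanish while a later one
  does not. Depth beyond D therefore requires a single tuple at which all of the first D iterates
  survive, not one tuple per iterate. In the commutator iteration, x_1 may lie outside
  $M_\<infinity>$; its first commutator with c = [x_2, x_3] lies inside, and then both elements sit
  in one finite unitriangular block, whose size bounds the number of further steps. A central kernel
  is harmless on both sides: it costs one more commutator in the iterated identity, and non-trivial
  values lift along an epimorphism onto \<open>G_inf\<close>. The statements on depth, identities
  and amenability are therefore phrased for any group with a suitable homomorphism to
  \<open>G_inf\<close>. The extension is of Heisenberg type: its cocycle at p is a cup product of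
  the superdiagonal, a crossed homomorphism, with its translate by p. Shift invariance of the
  pairing makes this work on all of \<open>G_inf\<close>. Because m_p and m_0 commute for every
  prime p, each prime can be switched on or off independently.\<close>

lemma word_eval_cong:
  "(\<And>i. i \<in> fst ` set w \<Longrightarrow> x i = y i) \<Longrightarrow> word_eval G x w = word_eval G y w"
  by (induction w) auto

lemma word_eval_hom:
  assumes "group G" "group H" "h \<in> hom G H" "x \<in> fst ` set w \<rightarrow> carrier G"
  shows "word_eval G x w \<in> carrier G \<and> word_eval H (h \<circ> x) w = h (word_eval G x w)"
proof -
  interpret group_hom G H h using assms by (simp add: group_hom_def group_hom_axioms_def)
  show ?thesis using assms(4) by (induction w) (auto simp: Pi_iff)
qed

context group
begin

lemma word_eval_closed: "x \<in> fst ` set w \<rightarrow> carrier G \<Longrightarrow> word_eval G x w \<in> carrier G"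
  using word_eval_hom[OF is_group is_group, of "\<lambda>y. y"] by (auto simp: hom_def)

lemma word_eval_push:
  assumes "x \<in> fst ` set (a # w) \<rightarrow> carrier G"
  shows "word_eval G x (push a w) = word_eval G x (a # w)"
proof (cases w)
  case (Cons b v)
  have v: "word_eval G x v \<in> carrier G" using assms Cons by (intro word_eval_closed) auto
  show ?thesis using Cons assms v
    by (auto simp: push_def inv_letter_def inv_solve_left' m_assoc[symmetric])
qed (simp add: push_def)

lemma word_eval_foldr_push:
  assumes "x \<in> fst ` set u \<union> fst ` set v \<rightarrow> carrier G"
  shows "word_eval G x (foldr push u v) = word_eval G x u \<otimes> word_eval G x v"
  using assms
proof (induction u)
  case (Cons a u)
  have "word_eval G x u \<in> carrier G" "word_eval G x v \<in> carrier G"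
    using Cons.prems by (auto intro!: word_eval_closed)
  moreover have "fst ` set (a # foldr push u v) \<subseteq> fst ` set (a # u) \<union> fst ` set v"
    using letters_foldr_push[of u v] by auto
  then have "x \<in> fst ` set (a # foldr push u v) \<rightarrow> carrier G"
    using Cons.prems by (meson Pi_anti_mono subsetD)
  ultimately show ?case using Cons by (simp add: word_eval_push Pi_iff m_assoc)
qed (simp add: word_eval_closed)

end

section \<open>The free group\<close>

lemma free_group_carrier: "w \<in> carrier (free_group n) \<longleftrightarrow> reduced w \<and> fst ` set w \<subseteq> {1..n}"
  and free_group_mult: "u \<otimes>\<^bsub>free_group n\<^esub> v = foldr push u v"
  and free_group_one: "\<one>\<^bsub>free_group n\<^esub> = []"
  by (simp_all add: free_group_def)

lemma reduced_Nil: "reduced []" by (simp add: reduced_def)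

lemma reduced_Cons: "reduced (a # w) \<longleftrightarrow> reduced w \<and> (w = [] \<or> hd w \<noteq> inv_letter a)"
  by (cases w) (auto simp: reduced_def)

lemma reduced_append:
  "reduced (u @ v) \<longleftrightarrow> reduced u \<and> reduced v \<and> (u = [] \<or> v = [] \<or> hd v \<noteq> inv_letter (last u))"
  by (auto simp: reduced_def successively_append_iff)

definition word_inv :: "letter list \<Rightarrow> letter list"
  where "word_inv u = rev (map inv_letter u)"

lemma inv_letter_eq_iff [simp]: "inv_letter a = inv_letter b \<longleftrightarrow> a = b"
  by (metis inv_letter_inv_letter)

lemma fst_inv_letter [simp]: "fst (inv_letter a) = fst a"
  by (simp add: inv_letter_def)

lemma inv_letter_neq [simp]: "inv_letter a \<noteq> a"
  by (metis inv_letter_def snd_conv)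

lemma reduced_word_inv: "reduced u \<Longrightarrow> reduced (word_inv u)"
  by (induction u) (auto simp: reduced_Cons reduced_append reduced_Nil word_inv_def last_rev hd_map)

lemma letters_word_inv [simp]: "fst ` set (word_inv u) = fst ` set u"
  by (simp add: word_inv_def image_image)

lemma word_inv_append [simp]: "word_inv (u @ v) = word_inv v @ word_inv u"
  and word_inv_word_inv [simp]: "word_inv (word_inv u) = u"
  and word_inv_Nil [simp]: "word_inv [] = []"
  and word_inv_Nil_iff [simp]: "word_inv u = [] \<longleftrightarrow> u = []"
  and hd_word_inv: "u \<noteq> [] \<Longrightarrow> hd (word_inv u) = inv_letter (last u)"
  and last_word_inv: "u \<noteq> [] \<Longrightarrow> last (word_inv u) = inv_letter (hd u)"
  by (simp_all add: word_inv_def rev_map o_def hd_rev last_rev last_map hd_map)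

lemma free_group_inv:
  assumes "u \<in> carrier (free_group n)"
  shows "inv\<^bsub>free_group n\<^esub> u = word_inv u"
proof -
  interpret group "free_group n" by (rule group_free_group)
  show ?thesis using assms foldr_push_inverse[of u] letters_word_inv[of u]
    by (intro inv_equality)
      (auto simp: free_group_carrier free_group_mult free_group_one word_inv_def[symmetric]
        reduced_word_inv)
qed

lemma gen_in_free_group [simp]: "gen i \<in> carrier (free_group n) \<longleftrightarrow> i \<in> {1..n}"
  by (simp add: gen_def free_group_carrier reduced_def)

lemma foldr_push_append_reduced: "reduced (u @ v) \<Longrightarrow> foldr push u v = u @ v"
  using foldr_push_reduced[of "u @ v"] foldr_push_reduced[of v] by (simp add: reduced_append)

lemma foldr_push_word_inv: "reduced v \<Longrightarrow> foldr push (word_inv u) (foldr push u v) = v"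
proof (induction u arbitrary: v)
  case (Cons a u)
  have "push (inv_letter a) (push a (foldr push u v)) = foldr push u v"
    using push_push_inv[of "foldr push u v" "inv_letter a"] Cons.prems
    by (simp add: reduced_foldr_push)
  then show ?case using Cons by (simp add: word_inv_def)
qed (simp add: word_inv_def)

section \<open>Substitution of words, and iterates as iterated self-maps\<close>

lemma word_eval_free_gen:
  assumes "w \<in> carrier (free_group n)"
  shows "word_eval (free_group n) gen w = w"
proof -
  have "fst ` set v \<subseteq> {1..n} \<Longrightarrow> word_eval (free_group n) gen v = foldr push v []" for v
    by (induction v)
      (auto simp: free_group_mult free_group_one free_group_inv gen_def word_inv_def
        inv_letter_def free_group_carrier reduced_def split: prod.splits)
  then show ?thesis using assms foldr_push_reduced[of w] by (simp add: free_group_carrier)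
qed

lemma (in group) word_eval_subst:
  assumes x: "x \<in> {1..n} \<rightarrow> carrier G" and y: "y \<in> {1..n} \<rightarrow> carrier (free_group n)"
    and w: "fst ` set w \<subseteq> {1..n}"
  shows "word_eval G x (word_eval (free_group n) y w) = word_eval G (word_eval G x \<circ> y) w"
proof -
  have "word_eval G x \<in> hom (free_group n) G"
    using x by (intro homI) (auto simp: free_group_carrier free_group_mult
        intro!: word_eval_closed word_eval_foldr_push)
  moreover have "y \<in> fst ` set w \<rightarrow> carrier (free_group n)" using y w by auto
  ultimately show ?thesis using word_eval_hom[OF group_free_group is_group] by metis
qed

lemma engel_iter_in_free_group:
  assumes "1 \<le> n" "w \<in> carrier (free_group n)"
  shows "engel_iter n w N \<in> carrier (free_group n)"
  using assms
proof (induction n w N rule: engel_iter.induct)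
  case (3 n w N)
  then show ?case unfolding engel_iter.simps
    by (intro group.word_eval_closed[OF group_free_group]) (auto simp: free_group_carrier[of w])
qed auto

text \<open>With x_2, ..., x_n frozen, w becomes a self-map of G in its first argument. The value
  \<open>gen 1\<close> at 0 makes the formula hold from N = 0 on, so later arguments can work with
  \<open>funpow\<close> alone.\<close>

lemma (in group) word_eval_engel_iter:
  assumes n: "1 \<le> n" and w: "w \<in> carrier (free_group n)" and x: "x \<in> {1..n} \<rightarrow> carrier G"
  shows "word_eval G x (engel_iter n w N) = ((\<lambda>y. word_eval G (x(1 := y)) w) ^^ N) (x 1)"
proof (induction N)
  case 0
  have "x 1 \<in> carrier G" using n x by auto
  then show ?case by (simp add: gen_def)
next
  case (Suc N)
  have gx: "word_eval G x (gen i) = x i" if "i \<in> {1..n}" for i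
    using that x by (simp add: gen_def Pi_iff)
  show ?case
  proof (cases N)
    case 0
    have "x(1 := x 1) = x" by (rule fun_upd_triv)
    then show ?thesis unfolding 0 by (simp only: engel_iter.simps funpow.simps o_apply id_apply)
  next
    case (Suc M)
    have "word_eval G x (engel_iter n w (Suc N)) =
        word_eval G (word_eval G x \<circ> gen(1 := engel_iter n w N)) w"
      unfolding Suc engel_iter.simps
      using w engel_iter_in_free_group[OF n w, of "Suc M"] n
      by (intro word_eval_subst[OF x]) (auto simp: free_group_carrier[of w] simp del: engel_iter.simps)
    also have "\<dots> = word_eval G (x(1 := word_eval G x (engel_iter n w N))) w"
      using w gx by (intro word_eval_cong) (auto simp: free_group_carrier)
    finally show ?thesis by (simp only: Suc.IH funpow.simps o_apply)
  qed
qed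

section \<open>Substitutions of the first variable\<close>

text \<open>Mutually inverse letters are peeled off the two ends until none match;
  \<open>reduced (t @ t)\<close> expresses that the remaining core is cyclically reduced.\<close>

lemma cyclic_decomposition:
  "reduced u \<Longrightarrow> u \<noteq> [] \<Longrightarrow> \<exists>s t. u = s @ t @ word_inv s \<and> t \<noteq> [] \<and> reduced (t @ t)"
proof (induction "length u" arbitrary: u rule: less_induct)
  case less
  show ?case
  proof (cases "reduced (u @ u)")
    case True
    then show ?thesis using less.prems by (intro exI[of _ "[]"] exI[of _ u]) (simp add: word_inv_def)
  next
    case False
    have hd: "hd u = inv_letter (last u)" using False less.prems by (simp add: reduced_append)
    obtain a u' where u: "u = a # u'" using less.prems by (cases u) auto
    have "a = inv_letter (last u)" using hd unfolding u by simp
    then have last: "last u = inv_letter a" by simp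
    then have "u' \<noteq> []" using u inv_letter_neq[of a] by (metis last.simps)
    then obtain v where v: "u = a # v @ [inv_letter a]"
      using u last by (metis append_butlast_last_id last.simps)
    then have "reduced v" "v \<noteq> []"
      using less.prems by (auto simp: reduced_Cons reduced_append)
    then obtain s t where "v = s @ t @ word_inv s" "t \<noteq> []" "reduced (t @ t)"
      using less.hyps[of v] v by auto
    then show ?thesis using v
      by (intro exI[of _ "a # s"] exI[of _ t]) (simp add: word_inv_def)
  qed
qed

text \<open>Only the inner pair s^-1 s cancels. The new seam between the two copies of
  \<open>t\<close> is reduced because \<open>t\<close> is cyclically reduced.\<close>

lemma foldr_push_conjugate:
  assumes "reduced (s @ t @ word_inv s)" "t \<noteq> []" "reduced (t @ t)" "reduced (s @ t @ r)"
  shows "foldr push (s @ t @ word_inv s) (s @ t @ r) = s @ t @ t @ r"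
proof -
  have r: "reduced (t @ r)" using assms(4) by (simp add: reduced_append)
  have "s @ t @ r = foldr push s (t @ r)"
    using foldr_push_append_reduced[of s "t @ r"] assms(4) by simp
  then have "foldr push (s @ t @ word_inv s) (s @ t @ r) = foldr push (s @ t) (t @ r)"
    using foldr_push_word_inv[OF r, of s] by simp
  moreover have "reduced ((s @ t) @ t @ r)"
    using assms r by (auto simp: reduced_append)
  ultimately show ?thesis using foldr_push_append_reduced[of "s @ t" "t @ r"] by simp
qed

lemma reduced_conjugate_inverse:
  assumes "reduced (s @ t @ word_inv s)" "reduced (t @ t)"
  shows "reduced (s @ word_inv t @ word_inv s)" "reduced (word_inv t @ word_inv t)"
  using reduced_word_inv[OF assms(1)] reduced_word_inv[OF assms(2)] by simp_all

text \<open>The prefix clause is the invariant that makes the induction work: it records how the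
  image of the tail begins, hence what a letter put in front can cancel. A power of x_1 becomes s
  t^k s^-1, and since \<open>u\<close> begins and ends with letters of x_1, nothing cancels against
  the other generators.\<close>

lemma subst_first_normal_form:
  assumes u: "u = s @ t @ word_inv s" "reduced u" "t \<noteq> []" "reduced (t @ t)"
    and ends: "fst (hd u) = 1" "fst (last u) = 1" and un: "fst ` set u \<subseteq> {1..n}"
    and z: "reduced z" "fst ` set z \<subseteq> {1..n}" "z \<noteq> []"
  shows "let v = word_eval (free_group n) (gen(1 := u)) z in
    reduced v \<and> v \<noteq> [] \<and> (fst (hd z) \<noteq> 1 \<longrightarrow> hd v = hd z) \<and>
    (fst (hd z) = 1 \<longrightarrow> (\<exists>r. v = s @ (if snd (hd z) then t else word_inv t) @ r))"
  using z
proof (induction z)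
  case (Cons l z)
  let ?e = "word_eval (free_group n) (gen(1 := u))"
  let ?t = "if snd l then t else word_inv t"
  have IH: "z \<noteq> [] \<Longrightarrow> let v = ?e z in reduced v \<and> v \<noteq> [] \<and> (fst (hd z) \<noteq> 1 \<longrightarrow> hd v = hd z) \<and>
    (fst (hd z) = 1 \<longrightarrow> (\<exists>r. v = s @ (if snd (hd z) then t else word_inv t) @ r))"
    using Cons.prems by (intro Cons.IH) (auto simp: reduced_Cons)
  have hdz: "z \<noteq> [] \<Longrightarrow> hd z \<noteq> inv_letter l" using Cons.prems by (auto simp: reduced_Cons)
  have e0: "?e [] = []" by (simp add: free_group_one)
  have red: "reduced (?e z)" using IH e0 by (cases "z = []") (auto simp: reduced_Nil Let_def)
  show ?case
  proof (cases "fst l = 1")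
    case False
    then have "?e (l # z) = push l (?e z)"
      using Cons.prems by (cases l)
        (auto simp: free_group_mult gen_def free_group_inv free_group_carrier reduced_def
          word_inv_def inv_letter_def)
    \<comment> \<open>An image that begins with \<open>s\<close> and a core begins like
      \<open>u\<close> or its inverse, hence with a letter of x_1, which \<open>l\<close> cannot
      cancel.\<close>
    moreover have "z \<noteq> [] \<Longrightarrow> fst (hd z) = 1 \<Longrightarrow> fst (hd (?e z)) = 1"
    proof -
      assume z: "z \<noteq> []" "fst (hd z) = 1"
      define t' where "t' = (if snd (hd z) then t else word_inv t)"
      obtain r where r: "?e z = s @ t' @ r" using IH z by (auto simp: Let_def t'_def)
      have "fst (hd (s @ t' @ word_inv s)) = 1"
        using u ends reduced_conjugate_inverse[of s t]
        by (cases "s = []") (auto simp: t'_def hd_word_inv)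
      moreover have "t' \<noteq> []" using u by (simp add: t'_def)
      ultimately show ?thesis using r by (cases "s = []") auto
    qed
    then have "?e z = [] \<or> hd (?e z) \<noteq> inv_letter l"
      using IH hdz False e0 unfolding Let_def by (metis fst_inv_letter)
    then have "push l (?e z) = l # ?e z" by (auto simp: push_def split: list.splits)
    ultimately have "?e (l # z) = l # ?e z" by (simp only:)
    then show ?thesis using False reduced_push[OF red, of l] \<open>push l (?e z) = l # ?e z\<close>
      unfolding Let_def by (simp only: list.sel) simp
  next
    case True
    define u' where "u' = s @ ?t @ word_inv s"
    have u'red: "reduced u'" "reduced (?t @ ?t)" "?t \<noteq> []"
      using u reduced_conjugate_inverse[of s t] by (auto simp: u'_def)
    have u'ends: "fst (last u') = 1"
      using u ends by (cases "s = []") (auto simp: u'_def last_word_inv)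
    have uc: "u \<in> carrier (free_group n)" using u un by (simp add: free_group_carrier)
    have u'_alt: "u' = (if snd l then u else word_inv u)" using u by (simp add: u'_def)
    have e: "?e (l # z) = foldr push u' (?e z)"
      using True uc by (auto simp: u'_alt free_group_mult free_group_inv)
    have "\<exists>r. ?e (l # z) = s @ ?t @ r"
    proof (cases "z = []")
      case True
      then show ?thesis using e e0 u'red foldr_push_reduced[of u'] by (auto simp: u'_def)
    next
      case z: False
      show ?thesis
      proof (cases "fst (hd z) = 1")
        case True
        \<comment> \<open>The tail continues with x_1 to the same power, the opposite one being
          excluded by reducedness, so the seam is that of
          \<open>foldr_push_conjugate\<close>.\<close>
        have "snd (hd z) = snd l"
          using hdz[OF z] True \<open>fst l = 1\<close> by (auto simp: inv_letter_def prod_eq_iff)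
        then obtain r where r: "?e z = s @ ?t @ r" using IH[OF z] True by (auto simp: Let_def)
        have "foldr push u' (?e z) = s @ ?t @ ?t @ r"
          unfolding r u'_def using u'red red r by (intro foldr_push_conjugate) (auto simp: u'_def)
        then show ?thesis using e by auto
      next
        case False
        then have "?e z \<noteq> []" "hd (?e z) = hd z" using IH[OF z] by (auto simp: Let_def)
        then have "hd (?e z) \<noteq> inv_letter (last u')" using u'ends False by (metis fst_inv_letter)
        then have "reduced (u' @ ?e z)" using u'red red by (simp add: reduced_append)
        then have "?e (l # z) = u' @ ?e z" unfolding e by (rule foldr_push_append_reduced)
        then show ?thesis unfolding u'_def append_assoc by blast
      qed
    qed
    then obtain r where r: "?e (l # z) = s @ ?t @ r" by blast
    have "reduced (?e (l # z))" unfolding e by (rule reduced_foldr_push[OF red])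
    then show ?thesis using True u'red unfolding Let_def list.sel r by auto
  qed
qed simp

text \<open>Write \<open>w = a u b\<close>, where \<open>u\<close> begins and ends with $x_1^{\pm 1}$ and \<open>a\<close>, \<open>b\<close> do not involve $x_1$.
  Then $x_1 \mapsto w$ is the automorphism $x_1 \mapsto a x_1 b$ followed by $x_1 \mapsto u$, and the latter
  is injective by the shape of its normal forms.\<close>

lemma subst_first_injective:
  assumes n: "1 \<le> n" and w: "w \<in> carrier (free_group n)" and occ: "1 \<in> fst ` set w"
    and z: "z \<in> carrier (free_group n)" "z \<noteq> []"
  shows "word_eval (free_group n) (gen(1 := w)) z \<noteq> []"
proof -
  interpret F: group "free_group n" by (rule group_free_group)
  let ?e = "\<lambda>u. word_eval (free_group n) (gen(1 := u))"
  define a where "a = takeWhile (\<lambda>l. fst l \<noteq> 1) w"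
  define v where "v = dropWhile (\<lambda>l. fst l \<noteq> 1) w"
  define u where "u = rev (dropWhile (\<lambda>l. fst l \<noteq> 1) (rev v))"
  define b where "b = rev (takeWhile (\<lambda>l. fst l \<noteq> 1) (rev v))"
  have "v = u @ b" unfolding u_def b_def by (metis rev_append rev_rev_ident takeWhile_dropWhile_id)
  then have weq: "w = a @ u @ b" unfolding a_def v_def by (metis takeWhile_dropWhile_id)
  have "\<exists>l\<in>set w. fst l = 1" using occ by (metis imageE)
  then have v: "v \<noteq> []" "fst (hd v) = 1"
    using hd_dropWhile[of "\<lambda>l. fst l \<noteq> 1" w] by (auto simp: v_def)
  then have "\<exists>l\<in>set (rev v). fst l = 1" by (auto intro!: bexI[of _ "hd v"])
  then have u: "u \<noteq> []" "fst (last u) = 1"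
    using hd_dropWhile[of "\<lambda>l. fst l \<noteq> 1" "rev v"] by (auto simp: u_def last_rev)
  have uhd: "fst (hd u) = 1" using v \<open>v = u @ b\<close> u by simp
  have ab: "1 \<notin> fst ` set a" "1 \<notin> fst ` set b"
    by (auto simp: a_def b_def dest: set_takeWhileD)
  have carr: "a \<in> carrier (free_group n)" "u \<in> carrier (free_group n)" "b \<in> carrier (free_group n)"
    using w weq by (auto simp: free_group_carrier reduced_append)
  have gen1: "gen 1 \<in> carrier (free_group n)" using n by simp
  define p where "p = a \<otimes>\<^bsub>free_group n\<^esub> gen 1 \<otimes>\<^bsub>free_group n\<^esub> b"
  \<comment> \<open>Substituting \<open>q\<close> for x_1 undoes the substitution of
    \<open>p\<close>, because \<open>a\<close> and \<open>b\<close> are fixed by every substitution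
    for x_1.\<close>
  define q where "q = inv\<^bsub>free_group n\<^esub> a \<otimes>\<^bsub>free_group n\<^esub> gen 1 \<otimes>\<^bsub>free_group n\<^esub> inv\<^bsub>free_group n\<^esub> b"
  have pq: "p \<in> carrier (free_group n)" "q \<in> carrier (free_group n)"
    using carr gen1 by (auto simp: p_def q_def)
  have fixed: "?e y c = c" if "1 \<notin> fst ` set c" "c \<in> carrier (free_group n)" for y c
    by (subst word_eval_cong[of c _ gen]) (use that word_eval_free_gen in \<open>auto simp: image_iff\<close>)
  have ep: "?e y p = a \<otimes>\<^bsub>free_group n\<^esub> y \<otimes>\<^bsub>free_group n\<^esub> b" if y: "y \<in> carrier (free_group n)" for y
  proof -
    have h: "?e y (c \<otimes>\<^bsub>free_group n\<^esub> d) = ?e y c \<otimes>\<^bsub>free_group n\<^esub> ?e y d"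
      if "c \<in> carrier (free_group n)" "d \<in> carrier (free_group n)" for c d
      unfolding free_group_mult[of n c d] using that y by (intro F.word_eval_foldr_push) (auto simp: free_group_carrier[of c] free_group_carrier[of d])
    have "?e y (gen 1) = y" using y by (simp add: gen_def)
    then show ?thesis
      using h[of "a \<otimes>\<^bsub>free_group n\<^esub> gen 1" b] h[of a "gen 1"] fixed[of a y] fixed[of b y] ab carr gen1
      by (simp add: p_def)
  qed
  have sub: "?e y (?e p z) = ?e (?e y p) z" if y: "y \<in> carrier (free_group n)" for y
  proof -
    have "?e y (?e p z) = word_eval (free_group n) (?e y \<circ> gen(1 := p)) z"
      using y pq z by (intro F.word_eval_subst) (auto simp: free_group_carrier[of z])
    also have "\<dots> = ?e (?e y p) z"
    proof (rule word_eval_cong)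
      fix i assume "i \<in> fst ` set z"
      then have "i \<in> {1..n}" using z by (auto simp: free_group_carrier)
      then show "(?e y \<circ> gen(1 := p)) i = (gen(1 := ?e y p)) i"
        using fixed[of "gen i" y] by (auto simp: gen_def free_group_carrier reduced_def)
    qed
    finally show ?thesis .
  qed
  have "?e q p = gen 1"
    using ep[OF pq(2)] carr gen1 by (simp add: q_def F.m_assoc F.inv_solve_left')
      (simp add: F.m_assoc[symmetric])
  then have "?e q (?e p z) = z" using sub[OF pq(2)] word_eval_free_gen[OF z(1)] by simp
  then have "?e p z \<noteq> []" using z by (auto simp: free_group_one)
  moreover have "?e p z \<in> carrier (free_group n)"
    using pq z by (intro F.word_eval_closed) (auto simp: free_group_carrier[of z])
  moreover obtain s t where "u = s @ t @ word_inv s" "t \<noteq> []" "reduced (t @ t)"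
    using cyclic_decomposition[of u] u carr by (auto simp: free_group_carrier)
  ultimately have "?e u (?e p z) \<noteq> []"
    using subst_first_normal_form[of u s t n "?e p z"] u uhd carr
    by (auto simp: free_group_carrier Let_def)
  moreover have "?e u p = w"
  proof -
    have "reduced (a @ u)" "reduced ((a @ u) @ b)"
      using w weq by (auto simp: free_group_carrier reduced_append)
    then have "foldr push a u = a @ u" "foldr push (a @ u) b = w"
      using weq by (simp_all only: foldr_push_append_reduced append_assoc)
    then show ?thesis using ep[OF carr(2)] by (simp only: free_group_mult)
  qed
  ultimately show ?thesis using sub[OF carr(2)] by simp
qed

text \<open>By definition the previous iterate is substituted into w. Powers of one map commute, so
  the next iterate is also obtained by substituting w for x_1 in the previous iterate, and
  \<open>subst_first_injective\<close> applies at each step. If x_1 does not occur in w, all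
  iterates equal w.\<close>

lemma engel_iter_nontrivial:
  assumes n: "1 \<le> n" and w: "w \<in> carrier (free_group n)" "w \<noteq> []"
  shows "engel_iter n w (Suc N) \<noteq> []"
proof -
  interpret F: group "free_group n" by (rule group_free_group)
  define f where "f y = word_eval (free_group n) (gen(1 := y)) w" for y
  have genx: "gen \<in> {1..n} \<rightarrow> carrier (free_group n)" by auto
  have it: "engel_iter n w M = (f ^^ M) (gen 1)" for M
    unfolding f_def using F.word_eval_engel_iter[OF n w(1) genx, of M]
      word_eval_free_gen[OF engel_iter_in_free_group[OF n w(1)], of M] by simp
  have w1: "w = f (gen 1)" using word_eval_free_gen[OF w(1)] by (simp add: f_def)
  show ?thesis
  proof (cases "1 \<in> fst ` set w")
    case False
    then have "f y = w" for y
      unfolding f_def by (subst word_eval_cong[of w _ gen]) (use False word_eval_free_gen w in \<open>auto simp: image_iff\<close>)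
    then show ?thesis using it w by simp
  next
    case True
    show ?thesis
    proof (induction N)
      case 0
      then show ?case using w by simp
    next
      case (Suc N)
      have "word_eval (free_group n) (gen(1 := w)) (engel_iter n w (Suc N)) = (f ^^ Suc N) w"
        using F.word_eval_engel_iter[OF n w(1), of "gen(1 := w)" "Suc N"] w genx
        unfolding f_def fun_upd_upd fun_upd_same by auto
      also have "\<dots> = (f ^^ Suc (Suc N)) (gen 1)"
        by (subst w1) (simp add: funpow_swap1)
      finally show ?case
        using subst_first_injective[OF n w(1) True engel_iter_in_free_group[OF n w(1)] Suc] it
        by metis
    qed
  qed
qed

section \<open>Unitriangular matrices\<close>

text \<open>For a \<ge> 1 and r \<ge> 0 these are the unitriangular matrices on the index block from
  -r to r whose first a - 1 superdiagonals vanish, extended by the identity. The block bounds the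
  nilpotency class, and \<open>a\<close> measures the depth in the central series.\<close>

definition unitri :: "int \<Rightarrow> int \<Rightarrow> int_matrix \<Rightarrow> bool"
  where "unitri r a A \<longleftrightarrow>
    (\<forall>i j. \<not> (- r \<le> i \<and> j \<le> r \<and> a \<le> j - i) \<longrightarrow> A i j = (if i = j then 1 else 0))"

lemma unitriD:
  "unitri r a A \<Longrightarrow> i < - r \<or> r < j \<or> j - i < a \<Longrightarrow> A i j = (if i = j then 1 else 0)"
  unfolding unitri_def by auto

lemma unitri_mono: "unitri r a A \<Longrightarrow> r \<le> r' \<Longrightarrow> a' \<le> a \<Longrightarrow> unitri r' a' A"
  unfolding unitri_def by auto

lemma unitri_one: "unitri r a (\<lambda>i j. if i = j then 1 else 0)"
  by (simp add: unitri_def)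

lemma matrices_one: "\<one>\<^bsub>matrices\<^esub> = (\<lambda>i j. if i = j then 1 else 0)"
  by (simp add: matrices_def)

lemma unitri_mult_entry:
  assumes A: "unitri r 1 A" and B: "unitri r' 1 B"
  shows "(A \<otimes>\<^bsub>matrices\<^esub> B) i j = (\<Sum>k\<in>{i..j}. A i k * B k j)"
proof -
  \<comment> \<open>Row i of A is supported on k = i and i < k \<le> r. Adding j to the bound makes
    the range contain {i..j}, to which the triangularity of B then cuts it down.\<close>
  have "(A \<otimes>\<^bsub>matrices\<^esub> B) i j = (\<Sum>k\<in>{i..max i (max j r)}. A i k * B k j)"
  proof (rule matrices_mult_superset)
    show "{k. A i k \<noteq> 0} \<subseteq> {i..max i (max j r)}"
    proof
      fix k assume "k \<in> {k. A i k \<noteq> 0}"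
      then show "k \<in> {i..max i (max j r)}"
        using unitriD[OF A, of i k] by (auto split: if_splits) (smt (verit))+
    qed
  qed simp
  also have "\<dots> = (\<Sum>k\<in>{i..j}. A i k * B k j)"
    using unitriD[OF B] by (intro sum.mono_neutral_right) auto
  finally show ?thesis .
qed

lemma sum_ends:
  fixes f :: "int \<Rightarrow> int"
  assumes "i < j" "\<And>k. i < k \<Longrightarrow> k < j \<Longrightarrow> f k = 0"
  shows "sum f {i..j} = f i + f j"
proof -
  have "sum f {i..j} = sum f {i, j}"
    using assms by (intro sum.mono_neutral_right) auto
  then show ?thesis using assms by simp
qed

text \<open>Write the factors as 1 + X and 1 + Y. The term XY starts only on superdiagonal a + b,
  which exceeds both \<open>a\<close> and \<open>b\<close>, so up to max a b the product is
  additive.\<close>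

lemma unitri_mult_low:
  assumes A: "unitri r a A" and B: "unitri r' b B" and ab: "1 \<le> a" "1 \<le> b"
    and ij: "i < j" "j - i \<le> a \<or> j - i \<le> b"
  shows "(A \<otimes>\<^bsub>matrices\<^esub> B) i j = A i j + B i j"
proof -
  have A1: "unitri r 1 A" and B1: "unitri r' 1 B" using A B ab by (auto intro: unitri_mono)
  have "(\<Sum>k\<in>{i..j}. A i k * B k j) = A i i * B i j + A i j * B j j"
  proof (rule sum_ends[OF ij(1)])
    fix k assume "i < k" "k < j"
    then show "A i k * B k j = 0"
      using ij unitriD[OF A, of i k] unitriD[OF B, of k j] by auto
  qed
  then show ?thesis
    using unitri_mult_entry[OF A1 B1] unitriD[OF A1, of i i] unitriD[OF B1, of j j] by simp
qed

lemma unitri_mult: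
  assumes A: "unitri r a A" and B: "unitri r a B" and a: "1 \<le> a"
  shows "unitri r a (A \<otimes>\<^bsub>matrices\<^esub> B)"
  unfolding unitri_def
proof (intro allI impI)
  fix i j assume out: "\<not> (- r \<le> i \<and> j \<le> r \<and> a \<le> j - i)"
  have A1: "unitri r 1 A" and B1: "unitri r 1 B" using A B a by (auto intro: unitri_mono)
  consider "j < i" | "i = j" | "i < j" by linarith
  then show "(A \<otimes>\<^bsub>matrices\<^esub> B) i j = (if i = j then 1 else 0)"
  proof cases
    case 3
    have "A i k * B k j = 0" if "k \<in> {i..j}" for k
      using that out 3 unitriD[OF A, of i k] unitriD[OF B, of k j]
        unitriD[OF A1, of i k] unitriD[OF B1, of k j] by (auto split: if_splits)
    then have "(\<Sum>k\<in>{i..j}. A i k * B k j) = 0" by (intro sum.neutral) blast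
    then show ?thesis using 3 unitri_mult_entry[OF A1 B1] by simp
  qed (use unitri_mult_entry[OF A1 B1] unitriD[OF A1, of i i] unitriD[OF B1, of i i] in auto)
qed

text \<open>The inverse is known beforehand only to be unitriangular in some unrelated block r'.
  Rows above the block of A are read off from AB = 1, where row i of A is that of the identity. All
  other entries are read off from BA = 1, where the relevant part of column j of A is that of the
  identity.\<close>

lemma unitri_inverse:
  assumes A: "unitri r a A" and B: "unitri r' 1 B" and a: "1 \<le> a"
    and AB: "A \<otimes>\<^bsub>matrices\<^esub> B = \<one>\<^bsub>matrices\<^esub>" and BA: "B \<otimes>\<^bsub>matrices\<^esub> A = \<one>\<^bsub>matrices\<^esub>"
  shows "unitri r a B"
  unfolding unitri_def
proof (intro allI impI)
  fix i j assume out: "\<not> (- r \<le> i \<and> j \<le> r \<and> a \<le> j - i)"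
  have A1: "unitri r 1 A" using A a by (auto intro: unitri_mono)
  show "B i j = (if i = j then 1 else 0)"
  proof (cases "i < j")
    case False
    then show ?thesis using unitriD[OF B, of i j] by simp
  next
    case ij: True
    show ?thesis
    proof (cases "i < - r")
      case True
      then have "A i k = (if i = k then 1 else 0)" for k using unitriD[OF A, of i k] by simp
      then have "(\<Sum>k\<in>{i..j}. A i k * B k j) = (\<Sum>k\<in>{i..j}. if i = k then B k j else 0)"
        by (intro sum.cong) auto
      then show ?thesis
        using unitri_mult_entry[OF A1 B, of i j] AB ij by (simp add: matrices_one)
    next
      case False
      then have "A k j = (if k = j then 1 else 0)" if "k \<in> {i..j}" for k
        using unitriD[OF A, of k j] out that by auto
      then have "(\<Sum>k\<in>{i..j}. B i k * A k j) = (\<Sum>k\<in>{i..j}. if k = j then B i k else 0)"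
        by (intro sum.cong) auto
      then show ?thesis
        using unitri_mult_entry[OF B A1, of i j] BA ij by (simp add: matrices_one)
    qed
  qed
qed

section \<open>Elements of \<open>M_inf\<close>\<close>

definition superdiag_matrix :: "int set \<Rightarrow> int \<Rightarrow> int_matrix"
  where "superdiag_matrix J e = (\<lambda>a b. if a = b then 1 else if b = a + 1 \<and> a \<in> J then e else 0)"

lemma superdiag_matrix_mult:
  "(superdiag_matrix J e \<otimes>\<^bsub>matrices\<^esub> B) a b = B a b + (if a \<in> J then e * B (a + 1) b else 0)"
  by (subst matrices_mult_superset[of "{a, a + 1}"]) (auto simp: superdiag_matrix_def)

lemma superdiag_matrix_carrier: "superdiag_matrix J e \<in> carrier matrices"
proof -
  have "{b. superdiag_matrix J e a b \<noteq> 0} \<subseteq> {a, a + 1}"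
    "{b. superdiag_matrix J e b a \<noteq> 0} \<subseteq> {a, a - 1}" for a
    by (auto simp: superdiag_matrix_def)
  then have "finite {b. superdiag_matrix J e a b \<noteq> 0}" "finite {b. superdiag_matrix J e b a \<noteq> 0}" for a
    by (meson finite.emptyI finite.insertI finite_subset)+
  then show ?thesis by (simp add: matrices_def)
qed

lemma elem_matrix_eq: "elem_matrix i = superdiag_matrix {i} 1"
  by (auto simp: elem_matrix_def superdiag_matrix_def fun_eq_iff)

lemma M_inf_carrier: "carrier M_inf = generate (units_of matrices) (range elem_matrix)"
proof -
  have "range elem_matrix \<subseteq> carrier (units_of matrices)"
    by (auto simp: units_of_def elem_matrix_Units)
  then show ?thesis by (simp add: M_inf_def carrier_subgroup_generated Int_absorb1)
qed

lemma M_inf_mult: "A \<otimes>\<^bsub>M_inf\<^esub> B = A \<otimes>\<^bsub>matrices\<^esub> B"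
  and M_inf_one: "\<one>\<^bsub>M_inf\<^esub> = \<one>\<^bsub>matrices\<^esub>"
  by (simp_all add: M_inf_def units_of_mult units_of_one)

lemma M_inf_Units: "A \<in> carrier M_inf \<Longrightarrow> A \<in> Units matrices"
  using group.carrier_subgroup_generated_subset[of "units_of matrices" "range elem_matrix"]
    monoid.units_group[OF monoid_matrices] by (auto simp: M_inf_def units_of_def)

lemma elem_matrix_in_M_inf: "elem_matrix i \<in> carrier M_inf"
  unfolding M_inf_carrier by (rule generate.incl) simp

lemma M_inf_inv: "A \<in> carrier M_inf \<Longrightarrow> inv\<^bsub>M_inf\<^esub> A = inv\<^bsub>matrices\<^esub> A"
  using group.inv_subgroup_generated[of "units_of matrices" A "range elem_matrix"]
    monoid.units_group[OF monoid_matrices] monoid.units_of_inv[OF monoid_matrices M_inf_Units[of A]]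
  by (simp add: M_inf_def)

text \<open>As J contains no two consecutive integers, N = \<Sum> E_{j,j+1} over J satisfies N^2 =
  0, so 1 + N and 1 - N are mutually inverse.\<close>

lemma superdiag_matrix_inverse:
  assumes "\<And>j. j \<in> J \<Longrightarrow> j + 1 \<notin> J"
  shows "superdiag_matrix J 1 \<otimes>\<^bsub>matrices\<^esub> superdiag_matrix J (-1) = \<one>\<^bsub>matrices\<^esub>"
    and "superdiag_matrix J (-1) \<otimes>\<^bsub>matrices\<^esub> superdiag_matrix J 1 = \<one>\<^bsub>matrices\<^esub>"
  using assms by (auto simp: fun_eq_iff superdiag_matrix_mult matrices_one) 
    (auto simp: superdiag_matrix_def)

text \<open>Elementary matrices at pairwise non-adjacent positions multiply without cross terms, so
  the product over J adds up their off-diagonal entries.\<close>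

lemma superdiag_matrix_in_M_inf:
  assumes "finite J" "\<And>j. j \<in> J \<Longrightarrow> j + 1 \<notin> J"
  shows "superdiag_matrix J 1 \<in> carrier M_inf"
  using assms
proof (induction J rule: finite_induct)
  case empty
  have "superdiag_matrix {} 1 = \<one>\<^bsub>M_inf\<^esub>"
    by (auto simp: superdiag_matrix_def M_inf_one matrices_one fun_eq_iff)
  then show ?case using group.is_monoid[OF group_M_inf] monoid.one_closed by metis
next
  case (insert j J)
  have "superdiag_matrix (insert j J) 1 = elem_matrix j \<otimes>\<^bsub>M_inf\<^esub> superdiag_matrix J 1"
    using insert.hyps insert.prems
    by (auto simp: fun_eq_iff elem_matrix_eq M_inf_mult superdiag_matrix_mult)
      (auto simp: superdiag_matrix_def)
  moreover have "superdiag_matrix J 1 \<in> carrier M_inf"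
    using insert by auto
  ultimately show ?case
    using group.is_monoid[OF group_M_inf] monoid.m_closed elem_matrix_in_M_inf by metis
qed

lemma superdiag_matrix_inv:
  assumes "finite J" "\<And>j. j \<in> J \<Longrightarrow> j + 1 \<notin> J"
  shows "inv\<^bsub>M_inf\<^esub> (superdiag_matrix J 1) = superdiag_matrix J (-1)"
proof -
  have "inv\<^bsub>matrices\<^esub> (superdiag_matrix J 1) = superdiag_matrix J (-1)"
    using superdiag_matrix_inverse[of J] assms(2)
    by (metis monoid.inv_char monoid_matrices superdiag_matrix_carrier)
  moreover have "superdiag_matrix J 1 \<in> carrier M_inf"
    by (rule superdiag_matrix_in_M_inf[OF assms(1)]) (rule assms(2))
  ultimately show ?thesis by (simp only: M_inf_inv)
qed

lemma unitri_superdiag_matrix: "J \<subseteq> {-r..<r} \<Longrightarrow> unitri r 1 (superdiag_matrix J e)"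
  unfolding unitri_def superdiag_matrix_def by auto

lemma M_inf_unitri:
  assumes "A \<in> carrier M_inf"
  shows "\<exists>r. unitri r 1 A"
  using assms unfolding M_inf_carrier
proof (induction rule: generate.induct)
  case one
  show ?case unfolding units_of_one matrices_one by (rule exI[of _ 0]) (rule unitri_one)
next
  case (incl A)
  then obtain i where A: "A = superdiag_matrix {i} 1" by (auto simp: elem_matrix_eq)
  show ?case unfolding A
    by (rule exI[of _ "\<bar>i\<bar> + 1"], rule unitri_superdiag_matrix) auto
next
  case (inv A)
  then obtain i where i: "A = elem_matrix i" by auto
  have "inv\<^bsub>units_of matrices\<^esub> A = inv\<^bsub>M_inf\<^esub> A"
    using M_inf_inv monoid.units_of_inv[OF monoid_matrices] elem_matrix_in_M_inf elem_matrix_Units i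
    by metis
  also have "\<dots> = superdiag_matrix {i} (-1)"
    using superdiag_matrix_inv[of "{i}"] i by (simp add: elem_matrix_eq)
  finally have A: "inv\<^bsub>units_of matrices\<^esub> A = superdiag_matrix {i} (-1)" .
  show ?case unfolding A
    by (rule exI[of _ "\<bar>i\<bar> + 1"], rule unitri_superdiag_matrix) auto
next
  case (eng A B)
  then obtain r r' where "unitri r 1 A" "unitri r' 1 B" by auto
  then have "unitri (max r r') 1 A" "unitri (max r r') 1 B" by (auto intro: unitri_mono)
  then show ?case unfolding units_of_mult by (blast intro: unitri_mult)
qed

section \<open>A filtration of the extension by the shift\<close>

lemma G_inf_simps:
  "carrier G_inf = carrier M_inf \<times> UNIV"
  "(A, k) \<otimes>\<^bsub>G_inf\<^esub> (B, l) = (A \<otimes>\<^bsub>matrices\<^esub> shift k B, k + l)"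
  "\<one>\<^bsub>G_inf\<^esub> = (\<one>\<^bsub>matrices\<^esub>, 0)"
  by (simp_all add: G_inf_def semidirect_product_def M_inf_mult M_inf_one)

lemma snd_G_inf_mult [simp]: "snd (x \<otimes>\<^bsub>G_inf\<^esub> y) = snd x + snd y"
  by (cases x; cases y) (simp add: G_inf_simps)

lemma shift_0 [simp]: "shift 0 A = A"
  by (simp add: shift_def)

text \<open>For fixed \<open>r\<close> and a = 1, 2, ... this is a descending central series of
  subgroups. It becomes trivial after 2r steps because indices in the block differ by at most
  2r.\<close>

definition filtration :: "int \<Rightarrow> int \<Rightarrow> (int_matrix \<times> int) set"
  where "filtration r a = {A \<in> carrier M_inf. unitri r a A} \<times> {0}"

lemma filtration_mono: "r \<le> r' \<Longrightarrow> a' \<le> a \<Longrightarrow> filtration r a \<subseteq> filtration r' a'"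
  by (auto simp: filtration_def intro: unitri_mono)

lemma G_inf_inv_matrix:
  assumes A: "A \<in> carrier M_inf"
  shows "inv\<^bsub>G_inf\<^esub> (A, 0) = (inv\<^bsub>M_inf\<^esub> A, 0)"
proof -
  have "inv\<^bsub>M_inf\<^esub> A \<in> carrier M_inf" "inv\<^bsub>M_inf\<^esub> A \<otimes>\<^bsub>M_inf\<^esub> A = \<one>\<^bsub>M_inf\<^esub>"
    using A group.inv_closed[OF group_M_inf] group.l_inv[OF group_M_inf] by auto
  then show ?thesis using A
    by (intro group.inv_equality[OF group_G_inf]) (auto simp: G_inf_simps M_inf_mult M_inf_one)
qed

lemma subgroup_filtration:
  assumes a: "1 \<le> a"
  shows "subgroup (filtration r a) G_inf"
proof (rule group.subgroupI[OF group_G_inf])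
  show "filtration r a \<subseteq> carrier G_inf" by (auto simp: filtration_def G_inf_simps)
  have "\<one>\<^bsub>G_inf\<^esub> \<in> filtration r a"
    using monoid.one_closed[OF group.is_monoid[OF group_M_inf]]
    by (simp add: filtration_def G_inf_simps M_inf_one) (simp add: matrices_one unitri_one)
  then show "filtration r a \<noteq> {}" by blast
next
  fix x assume "x \<in> filtration r a"
  then obtain A where x: "x = (A, 0)" "A \<in> carrier M_inf" "unitri r a A"
    by (auto simp: filtration_def)
  have inv: "inv\<^bsub>M_inf\<^esub> A \<in> carrier M_inf" "inv\<^bsub>M_inf\<^esub> A \<otimes>\<^bsub>M_inf\<^esub> A = \<one>\<^bsub>M_inf\<^esub>"
    "A \<otimes>\<^bsub>M_inf\<^esub> inv\<^bsub>M_inf\<^esub> A = \<one>\<^bsub>M_inf\<^esub>"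
    using x group.inv_closed[OF group_M_inf] group.l_inv[OF group_M_inf] group.r_inv[OF group_M_inf]
    by auto
  then obtain r' where "unitri r' 1 (inv\<^bsub>M_inf\<^esub> A)" using M_inf_unitri by blast
  then have "unitri r a (inv\<^bsub>M_inf\<^esub> A)"
    using inv unitri_inverse[OF x(3) _ a] by (simp add: M_inf_mult M_inf_one)
  then show "inv\<^bsub>G_inf\<^esub> x \<in> filtration r a"
    using x inv by (simp add: G_inf_inv_matrix filtration_def)
next
  fix x y assume "x \<in> filtration r a" "y \<in> filtration r a"
  then show "x \<otimes>\<^bsub>G_inf\<^esub> y \<in> filtration r a"
    using group.is_monoid[OF group_M_inf] monoid.m_closed[of M_inf]
    by (auto simp: filtration_def G_inf_simps intro!: unitri_mult[OF _ _ a])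
      (metis M_inf_mult)
qed

lemma (in group) commutator_eq:
  "x \<in> carrier G \<Longrightarrow> y \<in> carrier G \<Longrightarrow> commutator G x y = inv (y \<otimes> x) \<otimes> (x \<otimes> y)"
  by (simp add: commutator_def inv_mult_group m_assoc)

text \<open>The commutator is (CA)^-1 (AC). By \<open>unitri_mult_low\<close>, AC and CA agree up to
  superdiagonal \<open>a\<close>, so there the product agrees with (CA)^-1 (CA) = 1.\<close>

lemma commutator_filtration:
  assumes a: "1 \<le> a" and x: "x \<in> filtration r a" and y: "y \<in> filtration r 1"
  shows "commutator G_inf x y \<in> filtration r (a + 1)"
proof -
  interpret G: group G_inf by (rule group_G_inf)
  obtain A C where xy: "x = (A, 0)" "y = (C, 0)" "A \<in> carrier M_inf" "C \<in> carrier M_inf"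
    "unitri r a A" "unitri r 1 C"
    using x y by (auto simp: filtration_def)
  let ?P = "A \<otimes>\<^bsub>matrices\<^esub> C" and ?Q = "C \<otimes>\<^bsub>matrices\<^esub> A"
  have A1: "unitri r 1 A" using xy a by (auto intro: unitri_mono)
  have x1: "x \<in> filtration r 1" using x a filtration_mono[of r r 1 a] by auto
  have sub: "subgroup (filtration r 1) G_inf" by (rule subgroup_filtration) simp
  have car: "x \<in> carrier G_inf" "y \<in> carrier G_inf"
    using x1 y subgroup.mem_carrier[OF sub] by auto
  have qp: "y \<otimes>\<^bsub>G_inf\<^esub> x = (?Q, 0)" "x \<otimes>\<^bsub>G_inf\<^esub> y = (?P, 0)"
    by (simp_all add: xy G_inf_simps)
  have q: "(?Q, 0) \<in> filtration r 1" and p: "(?P, 0) \<in> filtration r 1"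
    using subgroup.m_closed[OF sub] x1 y qp by metis+
  then have "inv\<^bsub>G_inf\<^esub> (?Q, 0) \<in> filtration r 1"
    using subgroup.m_inv_closed[OF sub] by blast
  then obtain R where R: "inv\<^bsub>G_inf\<^esub> (?Q, 0) = (R, 0)" "unitri r 1 R" by (auto simp: filtration_def)
  have Q1: "unitri r 1 ?Q" and P1: "unitri r 1 ?P" using q p by (auto simp: filtration_def)
  have "(?Q, 0) \<in> carrier G_inf" using q subgroup.mem_carrier[OF sub] by blast
  then have RQ: "R \<otimes>\<^bsub>matrices\<^esub> ?Q = \<one>\<^bsub>matrices\<^esub>"
    using G.l_inv[OF \<open>(?Q, 0) \<in> carrier G_inf\<close>] unfolding R(1) by (simp add: G_inf_simps)
  have com: "commutator G_inf x y = (R \<otimes>\<^bsub>matrices\<^esub> ?P, 0)"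
    using G.commutator_eq[OF car] qp R by (simp add: G_inf_simps)
  then have com1: "(R \<otimes>\<^bsub>matrices\<^esub> ?P, 0) \<in> filtration r 1"
    using subgroup.m_closed[OF sub \<open>inv\<^bsub>G_inf\<^esub> (?Q, 0) \<in> filtration r 1\<close> p] R
    by (simp add: G_inf_simps)
  have PQ: "?P i j = ?Q i j" if "j - i < a + 1" for i j
  proof (cases "i < j")
    case True
    then show ?thesis
      using that a unitri_mult_low[OF xy(5,6)] unitri_mult_low[OF xy(6,5)] by simp
  qed (use unitriD[OF P1, of i j] unitriD[OF Q1, of i j] in auto)
  have "unitri r (a + 1) (R \<otimes>\<^bsub>matrices\<^esub> ?P)"
    unfolding unitri_def
  proof (intro allI impI)
    fix i j assume out: "\<not> (- r \<le> i \<and> j \<le> r \<and> a + 1 \<le> j - i)"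
    show "(R \<otimes>\<^bsub>matrices\<^esub> ?P) i j = (if i = j then 1 else 0)"
    proof (cases "j - i < a + 1")
      case True
      \<comment> \<open>All k in the sum satisfy k \<ge> i, so the entries at (k, j) also lie in the
        range where \<open>PQ\<close> applies.\<close>
      then have "(\<Sum>k\<in>{i..j}. R i k * ?P k j) = (\<Sum>k\<in>{i..j}. R i k * ?Q k j)"
        by (intro sum.cong) (auto simp: PQ)
      then have "(R \<otimes>\<^bsub>matrices\<^esub> ?P) i j = (R \<otimes>\<^bsub>matrices\<^esub> ?Q) i j"
        using unitri_mult_entry[OF R(2) P1] unitri_mult_entry[OF R(2) Q1] by simp
      then show ?thesis using RQ by (simp add: matrices_one)
    next
      case False
      then show ?thesis using com1 out unitriD[of r 1 "R \<otimes>\<^bsub>matrices\<^esub> ?P" i j]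
        by (auto simp: filtration_def)
    qed
  qed
  then show ?thesis using com com1 by (simp add: filtration_def)
qed

lemma filtration_trivial:
  assumes "2 * r < a" "1 \<le> a"
  shows "filtration r a = {\<one>\<^bsub>G_inf\<^esub>}"
proof
  show "filtration r a \<subseteq> {\<one>\<^bsub>G_inf\<^esub>}"
  proof
    fix x assume "x \<in> filtration r a"
    then obtain A where x: "x = (A, 0)" "unitri r a A" by (auto simp: filtration_def)
    have "A i j = (if i = j then 1 else 0)" for i j
      by (rule unitriD[OF x(2)]) (use assms in linarith)
    then show "x \<in> {\<one>\<^bsub>G_inf\<^esub>}" using x by (simp add: G_inf_simps matrices_one fun_eq_iff)
  qed
qed (use subgroup.one_closed[OF subgroup_filtration[OF assms(2)]] in auto)

lemma mem_filtration:
  assumes "x \<in> carrier G_inf" "snd x = 0"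
  shows "\<exists>r. x \<in> filtration r 1"
  using assms M_inf_unitri[of "fst x"] by (cases x) (auto simp: filtration_def G_inf_simps)

lemma snd_G_inf_hom: "snd \<in> hom G_inf integer_group"
  by (auto simp: hom_def G_inf_simps)

lemma snd_commutator:
  assumes "x \<in> carrier G_inf" "y \<in> carrier G_inf"
  shows "snd (commutator G_inf x y) = 0"
proof -
  interpret group_hom G_inf integer_group snd
    using group_G_inf group_integer_group snd_G_inf_hom
    by (simp add: group_hom_def group_hom_axioms_def)
  show ?thesis using assms by (simp add: commutator_def)
qed

text \<open>The integers have no torsion, so x lies in some \<open>filtration r 1\<close>. If x lies
  in \<open>filtration r a\<close>, superdiagonal \<open>a\<close> of x^n is n times that of x, so
  x^n = 1 pushes x into \<open>filtration r (a + 1)\<close>, and eventually into the trivial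
  group.\<close>

lemma G_inf_torsion_free:
  assumes x: "x \<in> carrier G_inf" and n: "0 < n" and pow: "x [^]\<^bsub>G_inf\<^esub> (n::nat) = \<one>\<^bsub>G_inf\<^esub>"
  shows "x = \<one>\<^bsub>G_inf\<^esub>"
proof -
  interpret G: group G_inf by (rule group_G_inf)
  have "snd (x [^]\<^bsub>G_inf\<^esub> m) = int m * snd x" for m :: nat
    by (induction m) (auto simp: G_inf_simps(3) algebra_simps)
  then have "snd x = 0" using n pow by (metis G_inf_simps(3) mult_eq_0_iff of_nat_eq_0_iff
        less_numeral_extra(3) snd_conv)
  then obtain r where r: "x \<in> filtration r 1" using mem_filtration x by blast
  have step: "x \<in> filtration r (a + 1)" if a: "1 \<le> a" and xa: "x \<in> filtration r a" for a
  proof -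
    obtain A where A: "x = (A, 0)" "A \<in> carrier M_inf" "unitri r a A"
      using xa by (auto simp: filtration_def)
    have sub: "subgroup (filtration r a) G_inf" by (rule subgroup_filtration[OF a])
    have p: "x [^]\<^bsub>G_inf\<^esub> m \<in> filtration r a \<and>
        (\<forall>i. fst (x [^]\<^bsub>G_inf\<^esub> m) i (i + a) = int m * A i (i + a))" for m :: nat
    proof (induction m)
      case 0
      then show ?case using subgroup.one_closed[OF sub] a by (simp add: G_inf_simps matrices_one)
    next
      case (Suc m)
      then obtain B where B: "x [^]\<^bsub>G_inf\<^esub> m = (B, 0)" "unitri r a B"
        "\<And>i. B i (i + a) = int m * A i (i + a)"
        by (auto simp: filtration_def)
      have "x [^]\<^bsub>G_inf\<^esub> Suc m = (B \<otimes>\<^bsub>matrices\<^esub> A, 0)" using B A by (simp add: G_inf_simps)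
      moreover have "x [^]\<^bsub>G_inf\<^esub> Suc m \<in> filtration r a"
        using Suc xa subgroup.m_closed[OF sub] by simp
      ultimately show ?case
        using unitri_mult_low[OF B(2) A(3) a a] B a by (simp add: algebra_simps)
    qed
    have "A i (i + a) = 0" for i
      using p[of n] pow n a by (auto simp: G_inf_simps matrices_one)
    then have "unitri r (a + 1) A"
      unfolding unitri_def
    proof (intro allI impI)
      fix i j assume out: "\<not> (- r \<le> i \<and> j \<le> r \<and> a + 1 \<le> j - i)" and z: "\<And>i. A i (i + a) = 0"
      show "A i j = (if i = j then 1 else 0)"
      proof (cases "j = i + a")
        case True
        then show ?thesis using z a by simp
      next
        case False
        then show ?thesis by (intro unitriD[OF A(3)]) (use out in linarith)
      qed
    qed
    then show ?thesis using A by (simp add: filtration_def)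
  qed
  have "x \<in> filtration r (1 + int m)" for m
  proof (induction m)
    case (Suc m)
    then show ?case using step[of "1 + int m"] by (simp add: algebra_simps)
  qed (use r in simp)
  then have "x \<in> filtration r (1 + int (nat (2 * r)))" by blast
  then show ?thesis using filtration_trivial[of r "1 + int (nat (2 * r))"] by auto
qed

section \<open>Separating words by unitriangular matrices\<close>

text \<open>The coefficient at the noncommutative monomial \<open>gs\<close> in the product of the factors
  \<open>1 \<plusminus> t\<^sub>i\<close> given by the letters of a word.\<close>

fun coef :: "letter list \<Rightarrow> nat list \<Rightarrow> int"
  where
    "coef [] gs = (if gs = [] then 1 else 0)"
  | "coef (l # v) [] = coef v []"
  | "coef (l # v) (g # gs) =
      coef v (g # gs) + (if g = fst l then (if snd l then 1 else -1) * coef v gs else 0)"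

definition syllables :: "letter list \<Rightarrow> nat list"
  where "syllables v = remdups_adj (map fst v)"

lemma syllables_Nil [simp]: "syllables [] = []"
  and syllables_Cons:
    "syllables (l # v) = (if v \<noteq> [] \<and> fst (hd v) = fst l then syllables v else fst l # syllables v)"
  and syllables_Nil_iff [simp]: "syllables v = [] \<longleftrightarrow> v = []"
  and hd_syllables: "v \<noteq> [] \<Longrightarrow> hd (syllables v) = fst (hd v)"
  and distinct_adj_syllables: "distinct_adj (syllables v)"
  and set_syllables: "set (syllables v) = fst ` set v"
proof -
  show "syllables [] = []" by (simp add: syllables_def)
  show "syllables (l # v) = (if v \<noteq> [] \<and> fst (hd v) = fst l then syllables v else fst l # syllables v)"
    by (cases v) (simp_all add: syllables_def)
  show "syllables v = [] \<longleftrightarrow> v = []" by (simp add: syllables_def)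
  show "v \<noteq> [] \<Longrightarrow> hd (syllables v) = fst (hd v)" by (simp add: syllables_def hd_map)
  show "distinct_adj (syllables v)" by (simp add: syllables_def)
  show "set (syllables v) = fst ` set v" by (simp add: syllables_def)
qed

text \<open>Neighbouring entries of \<open>gs\<close> differ, so they must be taken from different
  syllables of \<open>v\<close>. Hence \<open>gs\<close> cannot be longer than
  \<open>syllables v\<close>, and at equal length it must start with the first syllable. The two
  parts are proved together because removing the first entry can turn the first situation into the
  second.\<close>

lemma coef_eq_0:
  assumes "distinct_adj gs"
  shows "length gs > length (syllables v) \<Longrightarrow> coef v gs = 0"
    and "length gs = length (syllables v) \<Longrightarrow> v \<noteq> [] \<Longrightarrow> hd gs \<noteq> fst (hd v) \<Longrightarrow> coef v gs = 0"
  using assms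
proof (induction v arbitrary: gs)
  case (Cons l v)
  case 1
  obtain g gs' where gs: "gs = g # gs'" using 1 by (cases gs) auto
  have d: "distinct_adj gs'" "gs' = [] \<or> hd gs' \<noteq> g"
    using 1 gs by (auto simp: distinct_adj_Cons)
  have "coef v gs = 0"
    using Cons.IH(1)[of gs] 1 by (auto simp: syllables_Cons split: if_splits)
  moreover have "coef v gs' = 0" if "g = fst l"
  proof (cases "v \<noteq> [] \<and> fst (hd v) = fst l")
    \<comment> \<open>Here \<open>l\<close> prolongs the first syllable of \<open>v\<close>. The
      rest \<open>gs'\<close> has at least as many entries as \<open>syllables v\<close> and starts
      with a different generator, so one of the two hypotheses applies.\<close>
    case True
    then have "gs' \<noteq> []" using 1 gs by (auto simp: syllables_Cons)
    then show ?thesis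
      using 1 gs True d that Cons.IH(1)[of gs'] Cons.IH(2)[of gs']
      by (cases "length gs' = length (syllables v)") (auto simp: syllables_Cons)
  next
    case False
    then show ?thesis using 1 gs d Cons.IH(1)[of gs'] by (auto simp: syllables_Cons)
  qed
  ultimately show ?case using gs by simp
next
  case (Cons l v)
  case 2
  obtain g gs' where gs: "gs = g # gs'" using 2 by (cases gs) (auto simp: syllables_Cons split: if_splits)
  have "coef v gs = 0"
    using 2 Cons.IH(1)[of gs] Cons.IH(2)[of gs] by (auto simp: syllables_Cons split: if_splits)
  then show ?case using gs 2 by simp
qed auto

lemma coef_syllables:
  assumes "reduced v" "v \<noteq> []"
  shows "coef v (syllables v) \<noteq> 0"
proof -
  \<comment> \<open>\<open>m\<close> stands for the length of the first syllable, whose exponent is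
    \<open>m\<close> with the sign of the first letter. Peeling off one syllable at a time yields
    the product of all exponents.\<close>
  have "\<exists>m\<ge>1. coef v (syllables v) =
      m * (if snd (hd v) then 1 else -1) * coef v (tl (syllables v)) \<and>
    coef v (tl (syllables v)) \<noteq> 0"
    using assms
  proof (induction v)
    case (Cons l v)
    show ?case
    proof (cases "v = []")
      case True
      then show ?thesis by (intro exI[of _ 1]) (simp add: syllables_Cons)
    next
      case False
      have IH: "\<exists>m\<ge>1. coef v (syllables v) =
          m * (if snd (hd v) then 1 else -1) * coef v (tl (syllables v)) \<and>
        coef v (tl (syllables v)) \<noteq> 0"
        using Cons False by (auto simp: reduced_Cons)
      obtain g gs where g: "syllables v = g # gs" "g = fst (hd v)"
        using False hd_syllables[OF False] by (cases "syllables v") auto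
      have d: "gs = [] \<or> hd gs \<noteq> g"
        using distinct_adj_syllables[of v] g by (auto simp: distinct_adj_Cons)
      show ?thesis
      proof (cases "fst (hd v) = fst l")
        case True
        then have s: "snd (hd v) = snd l"
          using Cons.prems False by (auto simp: reduced_Cons inv_letter_def prod_eq_iff)
        obtain m where m: "m \<ge> 1" "coef v (g # gs) = m * (if snd l then 1 else -1) * coef v gs"
          "coef v gs \<noteq> 0" using IH g s by auto
        have "coef (l # v) gs = coef v gs"
          using d True g by (cases gs) auto
        moreover have "coef (l # v) (g # gs) = (m + 1) * (if snd l then 1 else -1) * coef v gs"
          using m True g by (simp add: algebra_simps)
        ultimately show ?thesis
          using m True False g by (intro exI[of _ "m + 1"]) (simp add: syllables_Cons)
      next
        case ne: False
        \<comment> \<open>A new syllable begins: the longer monomial does not occur in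
          \<open>v\<close>, so its coefficient comes only from choosing \<open>l\<close> as first
          factor.\<close>
        have "distinct_adj (fst l # syllables v)"
          using distinct_adj_syllables[of v] hd_syllables[OF False] ne g by (auto simp: distinct_adj_Cons)
        then have "coef v (fst l # syllables v) = 0" by (intro coef_eq_0(1)) auto
        moreover have "coef (l # v) (syllables v) = coef v (syllables v)"
          using g ne by simp
        moreover have "coef v (syllables v) \<noteq> 0" using IH by (cases "snd (hd v)") auto
        ultimately show ?thesis using ne by (intro exI[of _ 1]) (simp add: syllables_Cons)
      qed
    qed
  qed simp
  then obtain m where "m \<ge> 1" "coef v (syllables v) =
      m * (if snd (hd v) then 1 else -1) * coef v (tl (syllables v))" "coef v (tl (syllables v)) \<noteq> 0"
    by blast
  then show ?thesis by (cases "snd (hd v)") auto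
qed

text \<open>The entry \<open>(p, q)\<close> of a word in these matrices is the coefficient at the factor of \<open>L\<close> between
  the positions \<open>p\<close> and \<open>q\<close>. As no letter of \<open>L\<close> is repeated in succession, each matrix minus the
  identity squares to \<open>0\<close>.\<close>

definition path_tuple :: "nat list \<Rightarrow> nat \<Rightarrow> int_matrix \<times> int"
  where "path_tuple L i = (superdiag_matrix {int j |j. j < length L \<and> L ! j = i} 1, 0)"

lemma path_tuple_positions:
  assumes "distinct_adj L"
  shows "finite {int j |j. j < length L \<and> L ! j = i}"
    and "k \<in> {int j |j. j < length L \<and> L ! j = i} \<Longrightarrow> k + 1 \<notin> {int j |j. j < length L \<and> L ! j = i}"
proof -
  have "{int j |j. j < length L \<and> L ! j = i} = int ` {j. j < length L \<and> L ! j = i}" by auto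
  then show "finite {int j |j. j < length L \<and> L ! j = i}" by simp
  assume "k \<in> {int j |j. j < length L \<and> L ! j = i}"
  then obtain j where j: "k = int j" "j < length L" "L ! j = i" by auto
  show "k + 1 \<notin> {int j |j. j < length L \<and> L ! j = i}"
  proof
    assume "k + 1 \<in> {int j |j. j < length L \<and> L ! j = i}"
    then obtain j' where j': "k + 1 = int j'" "j' < length L" "L ! j' = i" by auto
    then have "j' = Suc j" using j by linarith
    then show False using j(3) j'(2,3) assms by (metis distinct_adj_conv_nth)
  qed
qed

lemma path_tuple_carrier:
  assumes "distinct_adj L"
  shows "path_tuple L i \<in> carrier G_inf"
    and "inv\<^bsub>G_inf\<^esub> (path_tuple L i) = (superdiag_matrix {int j |j. j < length L \<and> L ! j = i} (-1), 0)"
proof -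
  have M: "superdiag_matrix {int j |j. j < length L \<and> L ! j = i} 1 \<in> carrier M_inf"
    by (rule superdiag_matrix_in_M_inf[OF path_tuple_positions(1)[OF assms]])
      (rule path_tuple_positions(2)[OF assms])
  then show "path_tuple L i \<in> carrier G_inf" by (simp add: path_tuple_def G_inf_simps)
  have "inv\<^bsub>M_inf\<^esub> superdiag_matrix {int j |j. j < length L \<and> L ! j = i} 1 =
      superdiag_matrix {int j |j. j < length L \<and> L ! j = i} (-1)"
    by (rule superdiag_matrix_inv[OF path_tuple_positions(1)[OF assms]])
      (rule path_tuple_positions(2)[OF assms])
  then show "inv\<^bsub>G_inf\<^esub> (path_tuple L i) =
      (superdiag_matrix {int j |j. j < length L \<and> L ! j = i} (-1), 0)"
    unfolding path_tuple_def G_inf_inv_matrix[OF M] by simp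
qed

text \<open>The factor of the letter \<open>l\<close> has an off-diagonal entry in row p only if
  \<open>L ! p\<close> is the generator of \<open>l\<close>, and then in column p + 1. Left
  multiplication thus reproduces the recursion of \<open>coef\<close>, which keeps the monomial or
  drops its first entry.\<close>

lemma word_eval_path_tuple:
  assumes L: "distinct_adj L"
  shows "\<exists>W. word_eval G_inf (path_tuple L) v = (W, 0) \<and>
    (\<forall>p q. p \<le> q \<longrightarrow> q \<le> length L \<longrightarrow> W (int p) (int q) = coef v (take (q - p) (drop p L)))"
proof (induction v)
  case Nil
  then show ?case by (auto simp: G_inf_simps matrices_one)
next
  case (Cons l v)
  interpret G: group G_inf by (rule group_G_inf)
  obtain W where W: "word_eval G_inf (path_tuple L) v = (W, 0)"
    "\<And>p q. p \<le> q \<Longrightarrow> q \<le> length L \<Longrightarrow> W (int p) (int q) = coef v (take (q - p) (drop p L))"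
    using Cons by blast
  have "(W, 0) \<in> carrier G_inf"
    unfolding W(1)[symmetric] using path_tuple_carrier[OF L] by (intro G.word_eval_closed) auto
  then obtain r where r: "unitri r 1 W" using M_inf_unitri by (auto simp: G_inf_simps)
  let ?J = "{int j |j. j < length L \<and> L ! j = fst l}"
  let ?e = "if snd l then 1 else -1 :: int"
  let ?V = "superdiag_matrix ?J ?e \<otimes>\<^bsub>matrices\<^esub> W"
  have "word_eval G_inf (path_tuple L) (l # v) = (?V, 0)"
    using W path_tuple_carrier(2)[OF L] by (simp add: G_inf_simps) (simp add: path_tuple_def G_inf_simps)
  moreover have "?V (int p) (int q) = coef (l # v) (take (q - p) (drop p L))"
    if pq: "p \<le> q" "q \<le> length L" for p q
  proof (cases "p = q")
    case True
    \<comment> \<open>The monomial is empty here, and W vanishes at (q + 1, q) by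
      triangularity.\<close>
    then show ?thesis
      using W(2)[OF pq] unitriD[OF r, of "int q + 1" "int q"] by (simp add: superdiag_matrix_mult)
  next
    case False
    then have p: "p < length L" "Suc p \<le> q" using pq by auto
    have t: "take (q - p) (drop p L) = L ! p # take (q - Suc p) (drop (Suc p) L)"
      using p by (metis Cons_nth_drop_Suc Suc_diff_le diff_Suc_Suc take_Suc_Cons)
    have J: "int p \<in> ?J \<longleftrightarrow> L ! p = fst l" using p by auto
    have "?V (int p) (int q) = W (int p) (int q) + (if L ! p = fst l then ?e * W (int p + 1) (int q) else 0)"
      unfolding superdiag_matrix_mult J by simp
    also have "int p + 1 = int (Suc p)" by simp
    finally show ?thesis
      unfolding t coef.simps using W(2)[OF pq] W(2)[OF p(2) pq(2)] t by simp
  qed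
  ultimately show ?case by blast
qed

text \<open>Variables are numbered from 1, so 0 is free to separate the blocks. Keeping
  \<open>hd L \<noteq> 0\<close> allows a further block and separator to be put in front.\<close>

lemma separated_concatenation:
  assumes "\<And>gs. gs \<in> set gss \<Longrightarrow> distinct_adj gs \<and> 0 \<notin> set gs"
  shows "\<exists>L :: nat list. distinct_adj L \<and> (L \<noteq> [] \<longrightarrow> hd L \<noteq> 0) \<and>
    (\<forall>gs\<in>set gss. \<exists>pre post. L = pre @ gs @ post)"
  using assms
proof (induction gss)
  case (Cons gs gss)
  then obtain L where L: "distinct_adj L" "L \<noteq> [] \<longrightarrow> hd L \<noteq> 0"
    "\<forall>gs\<in>set gss. \<exists>pre post. L = pre @ gs @ post"
    by (metis list.set_intros(2))
  have gs: "distinct_adj gs" "0 \<notin> set gs" using Cons.prems by auto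
  show ?case
  proof (cases "gs = []")
    case True
    then show ?thesis using L by (intro exI[of _ L]) auto
  next
    case False
    then have "last gs \<noteq> 0" "hd gs \<noteq> 0" using gs by (metis last_in_set, metis hd_in_set)
    then have "distinct_adj (gs @ 0 # L)"
      using gs L by (auto simp: distinct_adj_append_iff distinct_adj_Cons)
    moreover have "\<exists>pre post. gs @ 0 # L = pre @ hs @ post" if "hs \<in> set (gs # gss)" for hs
    proof (cases "hs = gs")
      case True
      then show ?thesis by (metis append_Nil)
    next
      case False
      then have "hs \<in> set gss" using that by simp
      then obtain pre post where "L = pre @ hs @ post" using L(3) by blast
      then show ?thesis by (intro exI[of _ "gs @ 0 # pre"] exI[of _ post]) simp
    qed
    ultimately show ?thesis using False \<open>hd gs \<noteq> 0\<close> by (intro exI[of _ "gs @ 0 # L"]) auto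
  qed
qed (auto intro: exI[of _ "[]"])

lemma words_simultaneously_nontrivial:
  assumes "finite V" and V: "\<And>v. v \<in> V \<Longrightarrow> reduced v \<and> v \<noteq> [] \<and> 0 \<notin> fst ` set v"
  shows "\<exists>x. range x \<subseteq> carrier G_inf \<and> (\<forall>v\<in>V. word_eval G_inf x v \<noteq> \<one>\<^bsub>G_inf\<^esub>)"
proof -
  obtain vs where vs: "set vs = V" using finite_list[OF assms(1)] by blast
  obtain L where L: "distinct_adj L" "\<forall>gs\<in>set (map syllables vs). \<exists>pre post. L = pre @ gs @ post"
  proof -
    have "distinct_adj gs \<and> 0 \<notin> set gs" if gs: "gs \<in> set (map syllables vs)" for gs
    proof -
      obtain v where v: "v \<in> V" "gs = syllables v"
        using gs vs unfolding set_map by blast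
      then show ?thesis
        unfolding v(2) set_syllables using V[OF v(1)] distinct_adj_syllables by blast
    qed
    then show thesis using separated_concatenation[of "map syllables vs"] that by blast
  qed
  have "word_eval G_inf (path_tuple L) v \<noteq> \<one>\<^bsub>G_inf\<^esub>" if v: "v \<in> V" for v
  proof -
    obtain pre post where p: "L = pre @ syllables v @ post" using L(2) v vs by auto
    obtain W where W: "word_eval G_inf (path_tuple L) v = (W, 0)"
      "\<And>p q. p \<le> q \<Longrightarrow> q \<le> length L \<Longrightarrow> W (int p) (int q) = coef v (take (q - p) (drop p L))"
      using word_eval_path_tuple[OF L(1), of v] by blast
    \<comment> \<open>Between these two positions the path \<open>L\<close> reads exactly
      \<open>syllables v\<close>.\<close>
    have "W (int (length pre)) (int (length pre + length (syllables v))) = coef v (syllables v)"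
      using W(2)[of "length pre" "length pre + length (syllables v)"] p by simp
    then have "W (int (length pre)) (int (length pre + length (syllables v))) \<noteq> 0"
      using coef_syllables V[OF v] by simp
    moreover have "length (syllables v) \<noteq> 0" using V[OF v] by simp
    ultimately show ?thesis using W by (auto simp: G_inf_simps matrices_one)
  qed
  moreover have "range (path_tuple L) \<subseteq> carrier G_inf" using path_tuple_carrier[OF L(1)] by auto
  ultimately show ?thesis by blast
qed

section \<open>Iterational depth\<close>

lemma nontrivial_along_iteration:
  assumes "1 \<le> n" "w \<in> carrier (free_group n)" "w \<noteq> []"
  shows "\<exists>x. range x \<subseteq> carrier G_inf \<and>
    (\<forall>d. 1 \<le> d \<and> d \<le> D \<longrightarrow> word_eval G_inf x (engel_iter n w d) \<noteq> \<one>\<^bsub>G_inf\<^esub>)"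
proof -
  have "\<exists>x. range x \<subseteq> carrier G_inf \<and>
    (\<forall>v\<in>engel_iter n w ` {1..D}. word_eval G_inf x v \<noteq> \<one>\<^bsub>G_inf\<^esub>)"
  proof (rule words_simultaneously_nontrivial)
    fix v assume "v \<in> engel_iter n w ` {1..D}"
    then obtain d where d: "v = engel_iter n w d" "1 \<le> d" by auto
    then obtain d' where "d = Suc d'" by (cases d) auto
    then have "reduced v \<and> fst ` set v \<subseteq> {1..n}" "v \<noteq> []"
      using d engel_iter_in_free_group[OF assms(1,2), of d] engel_iter_nontrivial[OF assms, of d']
      unfolding free_group_carrier by metis+
    then show "reduced v \<and> v \<noteq> [] \<and> 0 \<notin> fst ` set v" by auto
  qed simp
  then obtain x where x: "range x \<subseteq> carrier G_inf \<and>
    (\<forall>v\<in>engel_iter n w ` {1..D}. word_eval G_inf x v \<noteq> \<one>\<^bsub>G_inf\<^esub>)" ..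
  have "engel_iter n w d \<in> engel_iter n w ` {1..D}" if "1 \<le> d \<and> d \<le> D" for d using that by simp
  then show ?thesis by (intro exI[of _ x]) (use x in blast)
qed

text \<open>Any preimages of a tuple that works in \<open>G_inf\<close> work in E, since a trivial
  value in E would have a trivial image. With \<open>id\<close> this covers \<open>G_inf\<close>
  itself.\<close>

lemma word_depth_over_G_inf:
  assumes E: "group E" and h: "h \<in> epi E G_inf"
    and w: "1 \<le> n" "w \<in> carrier (free_group n)" "w \<noteq> []"
  shows "\<exists>x \<in> {1..n} \<rightarrow> carrier E. \<forall>d. 1 \<le> d \<and> d \<le> D \<longrightarrow>
    word_eval E x (engel_iter n w d) \<noteq> \<one>\<^bsub>E\<^esub>"
proof -
  have hom: "h \<in> hom E G_inf" and surj: "h ` carrier E = carrier G_inf" using h by (auto simp: epi_def)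
  from nontrivial_along_iteration[OF w, of D]
  obtain x where x: "range x \<subseteq> carrier G_inf \<and>
    (\<forall>d. 1 \<le> d \<and> d \<le> D \<longrightarrow> word_eval G_inf x (engel_iter n w d) \<noteq> \<one>\<^bsub>G_inf\<^esub>)" ..
  have "\<forall>i. \<exists>y. y \<in> carrier E \<and> h y = x i" using x surj by (metis UNIV_I imageE image_eqI subsetD)
  then obtain y where y: "\<And>i. y i \<in> carrier E" "\<And>i. h (y i) = x i" by metis
  have "word_eval E y (engel_iter n w d) \<noteq> \<one>\<^bsub>E\<^esub>" if "1 \<le> d" "d \<le> D" for d
  proof -
    have "h \<circ> y = x" using y by auto
    then have "word_eval G_inf x (engel_iter n w d) = h (word_eval E y (engel_iter n w d))"
      using word_eval_hom[OF E group_G_inf hom, of y "engel_iter n w d"] y by auto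
    then show ?thesis using x that hom_one[OF hom E group_G_inf] by metis
  qed
  then show ?thesis using y(1) by auto
qed

lemma word_depth_infinite:
  assumes "group E" "h \<in> epi E G_inf" "1 \<le> n" "w \<in> carrier (free_group n)" "w \<noteq> []"
  shows "word_depth E n w = \<infinity>"
proof -
  have "{D. 1 \<le> D \<and> (\<forall>x \<in> {1..n} \<rightarrow> carrier E.
        \<exists>d. 1 \<le> d \<and> d \<le> D \<and> word_eval E x (engel_iter n w d) = \<one>\<^bsub>E\<^esub>)} = {}"
    using word_depth_over_G_inf[OF assms] by blast
  then show ?thesis unfolding word_depth_def by (simp only: image_empty Inf_empty) (simp add: top_ereal_def)
qed

lemma no_identity:
  assumes "group E" "h \<in> epi E G_inf" "1 \<le> n" "w \<in> carrier (free_group n)" "w \<noteq> []"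
  shows "\<not> satisfies_identity E n w"
proof -
  obtain x where "x \<in> {1..n} \<rightarrow> carrier E" "word_eval E x (engel_iter n w 1) \<noteq> \<one>\<^bsub>E\<^esub>"
    using word_depth_over_G_inf[OF assms, of 1] by auto
  then show ?thesis by (auto simp: satisfies_identity_def)
qed

section \<open>The iterated identity\<close>

lemma w_bar_eq: "w_bar = [(1, False), (3, False), (2, False), (3, True), (2, True), (1, True),
    (2, False), (3, False), (2, True), (3, True)]"
proof -
  let ?c = "[(2, False), (3, False), (2, True), (3, True)] :: letter list"
  have "inv\<^bsub>free_group 3\<^esub> (gen i) = [(i, False)]" if "i \<in> {1..3}" for i
  proof -
    have "inv\<^bsub>free_group 3\<^esub> (gen i) = word_inv (gen i)"
      by (rule free_group_inv) (simp only: gen_in_free_group that)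
    then show ?thesis by (simp add: gen_def word_inv_def inv_letter_def)
  qed
  moreover have c: "?c \<in> carrier (free_group 3)"
    by (auto simp: free_group_carrier reduced_Cons inv_letter_def reduced_Nil)
  ultimately show ?thesis
    using free_group_inv[OF c]
    by (simp add: w_bar_def commutator_def free_group_mult push_def inv_letter_def word_inv_def gen_def)
qed

lemma w_bar_nontrivial: "w_bar \<in> carrier (free_group 3)" "w_bar \<noteq> []"
  by (auto simp: w_bar_eq free_group_carrier reduced_Cons inv_letter_def reduced_Nil)

lemma (in group) word_eval_w_bar:
  assumes "x \<in> {1..3::nat} \<rightarrow> carrier G"
  shows "word_eval G x w_bar = commutator G (x 1) (commutator G (x 2) (x 3))"
proof -
  have "x 1 \<in> carrier G" "x 2 \<in> carrier G" "x 3 \<in> carrier G" using assms by auto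
  then show ?thesis by (simp add: w_bar_eq commutator_def inv_mult_group m_assoc)
qed

lemma (in group) commutator_closed:
  "x \<in> carrier G \<Longrightarrow> y \<in> carrier G \<Longrightarrow> commutator G x y \<in> carrier G"
  by (simp add: commutator_def)

lemma (in group) commutator_iterate_closed:
  "x \<in> carrier G \<Longrightarrow> c \<in> carrier G \<Longrightarrow> ((\<lambda>y. commutator G y c) ^^ N) x \<in> carrier G"
  by (induction N) (auto simp: commutator_closed)

text \<open>The inner commutator c = [x_2, x_3] stays fixed during the iteration, so the claim
  becomes an Engel condition with respect to commutators.\<close>

lemma (in group) satisfies_w_bar:
  assumes "\<And>x c y z. x \<in> carrier G \<Longrightarrow> y \<in> carrier G \<Longrightarrow> z \<in> carrier G \<Longrightarrow> c = commutator G y z \<Longrightarrow>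
    \<exists>N\<ge>1. ((\<lambda>y. commutator G y c) ^^ N) x = \<one>"
  shows "satisfies_iterated_identity G 3 w_bar"
  unfolding satisfies_iterated_identity_def
proof
  fix x :: "nat \<Rightarrow> 'a" assume x: "x \<in> {1..3} \<rightarrow> carrier G"
  then have xs: "x 1 \<in> carrier G" "x 2 \<in> carrier G" "x 3 \<in> carrier G" by auto
  define c where "c = commutator G (x 2) (x 3)"
  have c: "c \<in> carrier G" using xs by (simp add: c_def commutator_closed)
  have f: "word_eval G (x(1 := y)) w_bar = commutator G y c" if "y \<in> carrier G" for y
    using word_eval_w_bar[of "x(1 := y)"] that x by (auto simp: c_def Pi_iff)
  have "((\<lambda>y. word_eval G (x(1 := y)) w_bar) ^^ N) (x 1) = ((\<lambda>y. commutator G y c) ^^ N) (x 1)" for N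
  proof (induction N)
    case (Suc N)
    then show ?case using f[OF commutator_iterate_closed[OF xs(1) c, of N]]
      by (simp only: funpow.simps o_apply)
  qed simp
  moreover obtain N where "N \<ge> 1" "((\<lambda>y. commutator G y c) ^^ N) (x 1) = \<one>"
    using assms[OF xs c_def] by blast
  ultimately show "\<exists>N\<ge>1. word_eval G x (engel_iter 3 w_bar N) = \<one>"
    using word_eval_engel_iter[OF _ w_bar_nontrivial(1) x] by (intro exI[of _ N]) simp
qed

text \<open>One commutator removes the shift component of x. From then on the element and c lie in a
  common block \<open>r\<close>, and each further commutator with c goes one superdiagonal deeper;
  2r of them suffice.\<close>

lemma G_inf_engel:
  assumes "x \<in> carrier G_inf" "y \<in> carrier G_inf" "z \<in> carrier G_inf" "c = commutator G_inf y z"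
  shows "\<exists>N\<ge>1. ((\<lambda>y. commutator G_inf y c) ^^ N) x = \<one>\<^bsub>G_inf\<^esub>"
proof -
  interpret G: group G_inf by (rule group_G_inf)
  have c: "c \<in> carrier G_inf" "snd c = 0"
    using assms snd_commutator by (auto simp: G.commutator_closed)
  let ?x = "commutator G_inf x c"
  have "?x \<in> carrier G_inf" "snd ?x = 0" using assms c snd_commutator by (auto simp: G.commutator_closed)
  then obtain r1 r2 where r: "?x \<in> filtration r1 1" "c \<in> filtration r2 1"
    using mem_filtration c by blast
  define r where "r = max r1 r2"
  have x: "?x \<in> filtration r 1" and cr: "c \<in> filtration r 1"
    using r filtration_mono[of r1 r 1 1] filtration_mono[of r2 r 1 1] by (auto simp: r_def)
  have "((\<lambda>y. commutator G_inf y c) ^^ m) ?x \<in> filtration r (1 + int m)" for m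
  proof (induction m)
    case (Suc m)
    then show ?case using commutator_filtration[OF _ Suc cr] by (simp add: algebra_simps)
  qed (use x in simp)
  then have "((\<lambda>y. commutator G_inf y c) ^^ nat (2 * r)) ?x \<in> filtration r (1 + int (nat (2 * r)))"
    by blast
  moreover have "filtration r (1 + int (nat (2 * r))) = {\<one>\<^bsub>G_inf\<^esub>}"
    by (rule filtration_trivial) linarith+
  ultimately have "((\<lambda>y. commutator G_inf y c) ^^ nat (2 * r)) ?x = \<one>\<^bsub>G_inf\<^esub>" by blast
  then show ?thesis
    by (intro exI[of _ "Suc (nat (2 * r))"]) (simp only: funpow_Suc_right o_apply le_numeral_extra, simp)
qed

lemma G_inf_satisfies_w_bar: "satisfies_iterated_identity G_inf 3 w_bar"
  by (rule group.satisfies_w_bar[OF group_G_inf]) (rule G_inf_engel)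

text \<open>Once the image in \<open>G_inf\<close> is trivial, the iterate lies in the central
  kernel, and one further commutator gives 1.\<close>

lemma central_extension_satisfies_w_bar:
  assumes E: "group E" and h: "h \<in> hom E G_inf"
    and central: "\<And>x y. x \<in> carrier E \<Longrightarrow> y \<in> carrier E \<Longrightarrow> h x = \<one>\<^bsub>G_inf\<^esub> \<Longrightarrow>
      x \<otimes>\<^bsub>E\<^esub> y = y \<otimes>\<^bsub>E\<^esub> x"
  shows "satisfies_iterated_identity E 3 w_bar"
proof (rule group.satisfies_w_bar[OF E])
  fix x c y z assume xyz: "x \<in> carrier E" "y \<in> carrier E" "z \<in> carrier E" and c: "c = commutator E y z"
  interpret group_hom E G_inf h using E h group_G_inf by (simp add: group_hom_def group_hom_axioms_def)
  have hc: "h (commutator E u v) = commutator G_inf (h u) (h v)"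
    if "u \<in> carrier E" "v \<in> carrier E" for u v
    using that by (simp add: commutator_def)
  have cE: "c \<in> carrier E" using xyz by (simp add: c G.commutator_closed)
  have it: "h (((\<lambda>y. commutator E y c) ^^ N) x) = ((\<lambda>y. commutator G_inf y (h c)) ^^ N) (h x)" for N
    using hc G.commutator_iterate_closed[OF xyz(1) cE] cE by (induction N) auto
  obtain N where N: "N \<ge> 1" "((\<lambda>y. commutator G_inf y (h c)) ^^ N) (h x) = \<one>\<^bsub>G_inf\<^esub>"
    using G_inf_engel[of "h x" "h y" "h z" "h c"] xyz hc c by auto
  let ?u = "((\<lambda>y. commutator E y c) ^^ N) x"
  have u: "?u \<in> carrier E" using G.commutator_iterate_closed[OF xyz(1) cE] .
  have "commutator E ?u c = inv\<^bsub>E\<^esub> (c \<otimes>\<^bsub>E\<^esub> ?u) \<otimes>\<^bsub>E\<^esub> (?u \<otimes>\<^bsub>E\<^esub> c)"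
    using G.commutator_eq[OF u cE] .
  also have "\<dots> = \<one>\<^bsub>E\<^esub>" using central[OF u cE] it N u cE by simp
  finally show "\<exists>N\<ge>1. ((\<lambda>y. commutator E y c) ^^ N) x = \<one>\<^bsub>E\<^esub>"
    by (intro exI[of _ "Suc N"]) simp
qed

lemma fractalI:
  assumes "group E" "h \<in> epi E G_inf" "satisfies_iterated_identity E 3 w_bar"
  shows "fractal E"
proof -
  have "word_depth E 3 w_bar \<le> group_depth E"
    unfolding group_depth_def using assms(3) w_bar_nontrivial
    by (intro Sup_upper) (auto simp: free_group_one intro!: exI[of _ 3] exI[of _ w_bar])
  then show ?thesis
    using word_depth_infinite[OF assms(1,2) _ w_bar_nontrivial] by (simp add: fractal_def)
qed

section \<open>Elementary amenability\<close>

lemma elementary_amenable_step: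
  fixes K :: "'a monoid"
  assumes K: "group K" and N: "subgroup N K" and H: "subgroup H K" and NH: "N \<subseteq> H"
    and com: "\<And>x y. x \<in> H \<Longrightarrow> y \<in> H \<Longrightarrow> commutator K x y \<in> N"
    and ea: "elementary_amenable (K\<lparr>carrier := N\<rparr>)"
  shows "elementary_amenable (K\<lparr>carrier := H\<rparr>)"
proof -
  interpret K: group K by (rule K)
  let ?G = "K\<lparr>carrier := H\<rparr>"
  have G: "group ?G" by (rule K.subgroup_imp_group[OF H])
  interpret G: group ?G by (rule G)
  have HK: "x \<in> H \<Longrightarrow> x \<in> carrier K" for x using subgroup.mem_carrier[OF H] .
  have invG: "x \<in> H \<Longrightarrow> inv\<^bsub>?G\<^esub> x = inv\<^bsub>K\<^esub> x" for x
    using K.m_inv_consistent[OF H] by simp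
  \<comment> \<open>Inserting inverses into the convention u^-1 v^-1 u v gives x y x^-1 y^-1, the
    form suited to conjugation and right cosets.\<close>
  have conj: "x \<otimes>\<^bsub>K\<^esub> y \<otimes>\<^bsub>K\<^esub> inv\<^bsub>K\<^esub> x \<otimes>\<^bsub>K\<^esub> inv\<^bsub>K\<^esub> y \<in> N" if "x \<in> H" "y \<in> H" for x y
    using com[of "inv\<^bsub>K\<^esub> x" "inv\<^bsub>K\<^esub> y"] that HK subgroup.m_inv_closed[OF H]
    by (simp add: commutator_def)
  have normal: "N \<lhd> ?G"
    unfolding G.normal_inv_iff
  proof (intro conjI ballI)
    show "subgroup N ?G" by (rule K.subgroup_incl[OF N H NH])
    fix x h assume xh: "x \<in> carrier ?G" "h \<in> N"
    then have x: "x \<in> H" and h: "h \<in> H" using NH by auto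
    have "x \<otimes>\<^bsub>K\<^esub> h \<otimes>\<^bsub>K\<^esub> inv\<^bsub>K\<^esub> x =
        (x \<otimes>\<^bsub>K\<^esub> h \<otimes>\<^bsub>K\<^esub> inv\<^bsub>K\<^esub> x \<otimes>\<^bsub>K\<^esub> inv\<^bsub>K\<^esub> h) \<otimes>\<^bsub>K\<^esub> h"
      using HK[OF x] HK[OF h] by (simp add: K.m_assoc)
    then show "x \<otimes>\<^bsub>?G\<^esub> h \<otimes>\<^bsub>?G\<^esub> inv\<^bsub>?G\<^esub> x \<in> N"
      using invG[OF x] subgroup.m_closed[OF N conj[OF x h] xh(2)] by simp
  qed
  interpret N: normal N ?G by (rule normal)
  have "comm_group (?G Mod N)"
  proof (rule group.group_comm_groupI[OF N.factorgroup_is_group])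
    fix a b assume "a \<in> carrier (?G Mod N)" "b \<in> carrier (?G Mod N)"
    then obtain x y where xy: "x \<in> H" "y \<in> H" "a = N #>\<^bsub>?G\<^esub> x" "b = N #>\<^bsub>?G\<^esub> y"
      by (auto simp: FactGroup_def RCOSETS_def)
    have "x \<otimes>\<^bsub>K\<^esub> y = (x \<otimes>\<^bsub>K\<^esub> y \<otimes>\<^bsub>K\<^esub> inv\<^bsub>K\<^esub> x \<otimes>\<^bsub>K\<^esub> inv\<^bsub>K\<^esub> y) \<otimes>\<^bsub>K\<^esub> (y \<otimes>\<^bsub>K\<^esub> x)"
      using HK[OF xy(1)] HK[OF xy(2)] by (simp add: K.m_assoc K.inv_solve_left')
    then have "x \<otimes>\<^bsub>?G\<^esub> y \<in> N #>\<^bsub>?G\<^esub> (y \<otimes>\<^bsub>?G\<^esub> x)"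
      using conj[OF xy(1,2)] by (auto simp: r_coset_def)
    moreover have "y \<otimes>\<^bsub>?G\<^esub> x \<in> carrier ?G" using G.m_closed[of y x] xy by simp
    ultimately have "N #>\<^bsub>?G\<^esub> (y \<otimes>\<^bsub>?G\<^esub> x) = N #>\<^bsub>?G\<^esub> (x \<otimes>\<^bsub>?G\<^esub> y)"
      by (intro G.repr_independence[OF _ _ N.subgroup_axioms])
    then show "a \<otimes>\<^bsub>?G Mod N\<^esub> b = b \<otimes>\<^bsub>?G Mod N\<^esub> a"
      using xy N.rcos_sum by (simp add: FactGroup_def)
  qed
  then interpret Q: comm_group "?G Mod N" .
  \<comment> \<open>The rule \<open>extension\<close> wants a quotient group with elements of type
    'a, whereas cosets are sets. Choosing a representative of each coset transports the abelian
    quotient to that type.\<close>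
  define \<phi> where "\<phi> c = (SOME x. x \<in> c)" for c :: "'a set"
  have \<phi>: "\<phi> c \<in> c" if "c \<in> carrier (?G Mod N)" for c
  proof -
    obtain x where x: "x \<in> H" "c = N #>\<^bsub>?G\<^esub> x"
      using \<open>c \<in> carrier (?G Mod N)\<close> by (auto simp: FactGroup_def RCOSETS_def)
    then have "x \<in> c" using G.rcos_self[OF _ N.subgroup_axioms, of x] by simp
    then show ?thesis unfolding \<phi>_def by (rule someI)
  qed
  have "inj_on \<phi> (carrier (?G Mod N))"
  proof (rule inj_onI)
    fix a b assume ab: "a \<in> carrier (?G Mod N)" "b \<in> carrier (?G Mod N)" "\<phi> a = \<phi> b"
    then have "\<phi> a \<in> a \<inter> b" using \<phi>[of a] \<phi>[of b] by auto
    moreover have "a \<in> rcosets\<^bsub>?G\<^esub> N" "b \<in> rcosets\<^bsub>?G\<^esub> N" using ab by (auto simp: FactGroup_def)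
    ultimately show "a = b"
      using G.rcos_disjoint[OF N.subgroup_axioms] by (auto simp: pairwise_def disjnt_def)
  qed
  then have iso: "\<phi> \<in> iso (?G Mod N) (image_group \<phi> (?G Mod N))"
    and grp: "group (image_group \<phi> (?G Mod N))"
    by (rule inj_imp_image_group_iso, rule Q.inj_imp_image_group_is_group)
  then have "comm_group (image_group \<phi> (?G Mod N))"
    using Q.iso_imp_comm_group[OF is_isoI] group.is_monoid by blast
  then have "elementary_amenable (image_group \<phi> (?G Mod N))"
    by (rule elementary_amenable.abelian_group)
  moreover have "image_group \<phi> (?G Mod N) \<cong> ?G Mod N"
    using Q.iso_sym[OF is_isoI[OF iso]] .
  ultimately show ?thesis
    using elementary_amenable.extension[OF G normal] ea by simp
qed

text \<open>Subgroups of \<open>G_inf\<close> are pulled back to K. The chain starts at the abelian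
  kernel, climbs the filtration of each block by abelian quotients, takes the union over all blocks
  to reach the preimage of the shift-free part, and ends with a quotient embedded in the
  integers.\<close>

lemma elementary_amenable_over_G_inf:
  fixes K :: "'a monoid"
  assumes K: "group K" and h: "h \<in> hom K G_inf"
    and comm: "\<And>x y. x \<in> carrier K \<Longrightarrow> y \<in> carrier K \<Longrightarrow> h x = \<one>\<^bsub>G_inf\<^esub> \<Longrightarrow>
      h y = \<one>\<^bsub>G_inf\<^esub> \<Longrightarrow> x \<otimes>\<^bsub>K\<^esub> y = y \<otimes>\<^bsub>K\<^esub> x"
  shows "elementary_amenable K"
proof -
  interpret group_hom K G_inf h using K h group_G_inf by (simp add: group_hom_def group_hom_axioms_def)
  define P where "P S = {x \<in> carrier K. h x \<in> S}" for S
  have subP: "subgroup (P S) K" if "subgroup S G_inf" for S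
  proof (rule G.subgroupI)
    have "\<one>\<^bsub>K\<^esub> \<in> P S" using subgroup.one_closed[OF that] by (simp add: P_def)
    then show "P S \<noteq> {}" by blast
  qed (use subgroup.m_closed[OF that] subgroup.m_inv_closed[OF that] in \<open>auto simp: P_def\<close>)
  have hcom: "h (commutator K x y) = commutator G_inf (h x) (h y)"
    if "x \<in> carrier K" "y \<in> carrier K" for x y
    using that by (simp add: commutator_def)
  have step: "elementary_amenable (K\<lparr>carrier := P S\<rparr>)"
    if "subgroup S G_inf" "subgroup T G_inf" "T \<subseteq> S"
      "\<And>x y. x \<in> S \<Longrightarrow> y \<in> S \<Longrightarrow> commutator G_inf x y \<in> T"
      "elementary_amenable (K\<lparr>carrier := P T\<rparr>)" for S T
  proof (rule elementary_amenable_step[OF K subP[OF that(2)] subP[OF that(1)] _ _ that(5)])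
    show "P T \<subseteq> P S" using that(3) by (auto simp: P_def)
    fix x y assume "x \<in> P S" "y \<in> P S"
    then show "commutator K x y \<in> P T"
      using that(4)[of "h x" "h y"] by (simp add: P_def hcom G.commutator_closed)
  qed
  have triv: "elementary_amenable (K\<lparr>carrier := P {\<one>\<^bsub>G_inf\<^esub>}\<rparr>)"
  proof (rule elementary_amenable.abelian_group, rule group.group_comm_groupI)
    show "group (K\<lparr>carrier := P {\<one>\<^bsub>G_inf\<^esub>}\<rparr>)"
      by (rule G.subgroup_imp_group[OF subP]) (rule group.triv_subgroup[OF group_G_inf])
  qed (auto simp: P_def comm)
  have filt: "elementary_amenable (K\<lparr>carrier := P (filtration r a)\<rparr>)" if "1 \<le> a" for r a
    using that
  \<comment> \<open>Downward induction on \<open>a\<close>, starting beyond 2r, where the filtration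
    is trivial and its preimage is the kernel.\<close>
  proof (induction "nat (2 * r + 1 - a)" arbitrary: a)
    case 0
    then have "filtration r a = {\<one>\<^bsub>G_inf\<^esub>}" by (intro filtration_trivial) auto
    then show ?case using triv by simp
  next
    case (Suc m)
    have "elementary_amenable (K\<lparr>carrier := P (filtration r (a + 1))\<rparr>)"
      using Suc by (intro Suc.hyps(1)) auto
    moreover have "commutator G_inf x y \<in> filtration r (a + 1)"
      if "x \<in> filtration r a" "y \<in> filtration r a" for x y
      using that Suc.prems filtration_mono[of r r 1 a] by (intro commutator_filtration) auto
    ultimately show ?case
      using Suc.prems by (intro step[of "filtration r a" "filtration r (a + 1)"] subgroup_filtration
          filtration_mono) auto
  qed
  define Z where "Z = {x \<in> carrier G_inf. snd x = 0}"
  have snd_inv: "snd (inv\<^bsub>G_inf\<^esub> x) = - snd x" if "x \<in> carrier G_inf" for x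
  proof -
    have "snd (inv\<^bsub>G_inf\<^esub> x \<otimes>\<^bsub>G_inf\<^esub> x) = snd \<one>\<^bsub>G_inf\<^esub>" using H.l_inv[OF that] by simp
    then show ?thesis by (simp add: G_inf_simps(3))
  qed
  have Z: "subgroup Z G_inf"
  proof (rule H.subgroupI)
    have "\<one>\<^bsub>G_inf\<^esub> \<in> Z" unfolding Z_def using H.one_closed by (simp add: G_inf_simps(3))
    then show "Z \<noteq> {}" by blast
  qed (auto simp: Z_def snd_inv)
  have filtZ: "filtration r 1 \<subseteq> Z" for r by (auto simp: filtration_def Z_def G_inf_simps)
  have "elementary_amenable (K\<lparr>carrier := P Z\<rparr>)"
  proof (rule elementary_amenable.directed_union)
    let ?\<H> = "range (\<lambda>r. P (filtration r 1))"
    show "group (K\<lparr>carrier := P Z\<rparr>)" by (rule G.subgroup_imp_group[OF subP[OF Z]])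
    show "?\<H> \<noteq> {}" by simp
    show "\<forall>H\<in>?\<H>. subgroup H (K\<lparr>carrier := P Z\<rparr>) \<and>
        elementary_amenable (K\<lparr>carrier := P Z, carrier := H\<rparr>)"
    proof
      fix H assume "H \<in> ?\<H>"
      then obtain r where r: "H = P (filtration r 1)" by auto
      have "subgroup H (K\<lparr>carrier := P Z\<rparr>)"
        unfolding r using filtZ by (intro G.subgroup_incl subP subgroup_filtration Z) (auto simp: P_def)
      then show "subgroup H (K\<lparr>carrier := P Z\<rparr>) \<and>
          elementary_amenable (K\<lparr>carrier := P Z, carrier := H\<rparr>)"
        using filt[of 1 r] r by simp
    qed
    show "\<forall>H\<in>?\<H>. \<forall>L\<in>?\<H>. \<exists>M\<in>?\<H>. H \<union> L \<subseteq> M"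
    proof (intro ballI)
      fix H L assume "H \<in> ?\<H>" "L \<in> ?\<H>"
      then obtain r s where "H = P (filtration r 1)" "L = P (filtration s 1)" by auto
      then have "H \<union> L \<subseteq> P (filtration (max r s) 1)"
        using filtration_mono[of r "max r s" 1 1] filtration_mono[of s "max r s" 1 1]
        by (auto simp: P_def)
      then show "\<exists>M\<in>?\<H>. H \<union> L \<subseteq> M" by blast
    qed
    show "\<Union> ?\<H> = carrier (K\<lparr>carrier := P Z\<rparr>)"
    proof -
      have "Z = (\<Union>r. filtration r 1)"
      proof (intro equalityI subsetI)
        fix x assume "x \<in> Z"
        then obtain r where "x \<in> filtration r 1" using mem_filtration[of x] by (auto simp: Z_def)
        then show "x \<in> (\<Union>r. filtration r 1)" by (rule UN_I[OF UNIV_I])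
      qed (use filtZ in auto)
      then show ?thesis by (auto simp: P_def)
    qed
  qed
  then have "elementary_amenable (K\<lparr>carrier := P (carrier G_inf)\<rparr>)"
    using snd_commutator
    by (intro step[OF H.subgroup_self Z]) (auto simp: Z_def H.commutator_closed)
  moreover have "K\<lparr>carrier := P (carrier G_inf)\<rparr> = K" by (auto simp: P_def intro!: monoid.equality)
  ultimately show ?thesis by simp
qed

section \<open>Central extensions with prescribed torsion\<close>

definition superdiag :: "int_matrix \<times> int \<Rightarrow> int \<Rightarrow> int"
  where "superdiag x i = fst x i (i + 1)"

lemma finite_superdiag:
  assumes "x \<in> carrier G_inf"
  shows "finite {i. superdiag x (i + c) \<noteq> 0}"
proof -
  obtain r where r: "unitri r 1 (fst x)" using assms M_inf_unitri[of "fst x"] by (auto simp: G_inf_simps)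
  have "{i. superdiag x (i + c) \<noteq> 0} \<subseteq> {- r - c..r - c}"
  proof
    fix i assume "i \<in> {i. superdiag x (i + c) \<noteq> 0}"
    then have "\<not> (i + c < - r \<or> r < i + c + 1)"
      using unitriD[OF r, of "i + c" "i + c + 1"] by (auto simp: superdiag_def)
    then show "i \<in> {- r - c..r - c}" by simp
  qed
  then show ?thesis by (rule finite_subset) simp
qed

lemma superdiag_one: "superdiag \<one>\<^bsub>G_inf\<^esub> i = 0"
  by (simp add: superdiag_def G_inf_simps matrices_one)

text \<open>On the first superdiagonal unitriangular matrices add, so \<open>superdiag\<close> is a
  crossed homomorphism for the translation action of the shift component.\<close>

lemma superdiag_mult:
  assumes x: "x \<in> carrier G_inf" and y: "y \<in> carrier G_inf"
  shows "superdiag (x \<otimes>\<^bsub>G_inf\<^esub> y) i = superdiag x i + superdiag y (i - snd x)"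
proof -
  obtain A k B l where xy: "x = (A, k)" "y = (B, l)" by (cases x; cases y)
  have A: "A \<in> carrier M_inf" and B: "shift k B \<in> carrier M_inf"
    using x y xy shift_M_inf[of k] by (auto simp: G_inf_simps hom_def)
  obtain r r' where r: "unitri r 1 A" "unitri r' 1 (shift k B)"
    using M_inf_unitri[OF A] M_inf_unitri[OF B] by blast
  have "(A \<otimes>\<^bsub>matrices\<^esub> shift k B) i (i + 1) = A i (i + 1) + shift k B i (i + 1)"
    by (rule unitri_mult_low[OF r]) simp_all
  moreover have "i + 1 - k = i - k + 1" by simp
  ultimately show ?thesis by (simp add: xy superdiag_def G_inf_simps shift_def)
qed

section \<open>The translation-invariant pairing and its 2-cocycles\<close>

definition pairing :: "(int \<Rightarrow> int) \<Rightarrow> (int \<Rightarrow> int) \<Rightarrow> int"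
  where "pairing a b = (\<Sum>i | a i \<noteq> 0. a i * b i)"

lemma pairing_superset: "finite T \<Longrightarrow> {i. a i \<noteq> 0} \<subseteq> T \<Longrightarrow> pairing a b = (\<Sum>i\<in>T. a i * b i)"
  unfolding pairing_def by (rule sum.mono_neutral_left) auto

lemma pairing_translate: "pairing (\<lambda>i. a (i - k)) (\<lambda>i. b (i - k)) = pairing a b"
  unfolding pairing_def
  by (rule sum.reindex_bij_witness[of _ "\<lambda>i. i + k" "\<lambda>i. i - k"]) auto

text \<open>In the extension, conjugates of \<open>m\<^sub>0\<close> by powers of \<open>\<phi>\<close> that are \<open>p\<close> steps apart have a
  commutator whose only non-trivial central coordinate is the one at \<open>p\<close>.\<close>

definition cocycle :: "int_matrix \<times> int \<Rightarrow> int_matrix \<times> int \<Rightarrow> nat \<Rightarrow> int"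
  where "cocycle x y p = pairing (\<lambda>i. superdiag x (i + int p)) (\<lambda>i. superdiag y (i - snd x))"

lemma cocycle_one: "cocycle \<one>\<^bsub>G_inf\<^esub> x p = 0" "cocycle x \<one>\<^bsub>G_inf\<^esub> p = 0"
  by (simp_all add: cocycle_def pairing_def superdiag_one)

text \<open>This is the 2-cocycle identity of a cup product of crossed homomorphisms. By bilinearity
  both sides equal \<langle>a, c\<rangle> + \<langle>a, d\<rangle> + \<langle>b, d\<rangle> in the
  notation of the proof; translation invariance rewrites \<open>cocycle y z p\<close> as the last
  term.\<close>

lemma cocycle_assoc:
  assumes x: "x \<in> carrier G_inf" and y: "y \<in> carrier G_inf" and z: "z \<in> carrier G_inf"
  shows "cocycle x y p + cocycle (x \<otimes>\<^bsub>G_inf\<^esub> y) z p =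
    cocycle y z p + cocycle x (y \<otimes>\<^bsub>G_inf\<^esub> z) p"
proof -
  let ?k = "snd x"
  define a where "a i = superdiag x (i + int p)" for i
  define b where "b i = superdiag y (i - ?k + int p)" for i
  define c where "c i = superdiag y (i - ?k)" for i
  define d where "d i = superdiag z (i - ?k - snd y)" for i
  \<comment> \<open>A single finite set containing both supports, so that all four pairings become
    sums over the same range.\<close>
  define T where "T = {i. a i \<noteq> 0} \<union> {i. b i \<noteq> 0}"
  have T: "finite T"
    using finite_superdiag[OF x, of "int p"] finite_superdiag[OF y, of "int p - ?k"]
    by (simp add: T_def a_def b_def algebra_simps)
  have "cocycle x y p = (\<Sum>i\<in>T. a i * c i)"
    unfolding cocycle_def a_def[symmetric] c_def[symmetric]
    by (rule pairing_superset[OF T]) (auto simp: T_def)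
  moreover have "cocycle (x \<otimes>\<^bsub>G_inf\<^esub> y) z p = (\<Sum>i\<in>T. (a i + b i) * d i)"
  proof -
    have "superdiag (x \<otimes>\<^bsub>G_inf\<^esub> y) (i + int p) = a i + b i" for i
      using superdiag_mult[OF x y, of "i + int p"] by (simp add: a_def b_def algebra_simps)
    moreover have "superdiag z (i - snd (x \<otimes>\<^bsub>G_inf\<^esub> y)) = d i" for i
      by (simp add: d_def algebra_simps)
    ultimately show ?thesis
      unfolding cocycle_def by (simp only:) (rule pairing_superset[OF T], auto simp: T_def)
  qed
  moreover have "cocycle y z p = (\<Sum>i\<in>T. b i * d i)"
  proof -
    have "cocycle y z p = pairing b d"
      unfolding cocycle_def b_def d_def
      using pairing_translate[of "\<lambda>i. superdiag y (i + int p)" ?k "\<lambda>i. superdiag z (i - snd y)"]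
      by simp
    also have "\<dots> = (\<Sum>i\<in>T. b i * d i)" by (rule pairing_superset[OF T]) (auto simp: T_def)
    finally show ?thesis .
  qed
  moreover have "cocycle x (y \<otimes>\<^bsub>G_inf\<^esub> z) p = (\<Sum>i\<in>T. a i * (c i + d i))"
  proof -
    have "superdiag (y \<otimes>\<^bsub>G_inf\<^esub> z) (i - ?k) = c i + d i" for i
      using superdiag_mult[OF y z, of "i - ?k"] by (simp add: c_def d_def algebra_simps)
    then show ?thesis
      unfolding cocycle_def a_def[symmetric]
      by (simp only:) (rule pairing_superset[OF T], auto simp: T_def)
  qed
  ultimately show ?thesis
    by (simp only: distrib_left distrib_right sum.distrib)
qed

definition center_modulus :: "nat set \<Rightarrow> nat \<Rightarrow> int"
  where "center_modulus S p = (if p \<in> S then int p else 1)"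

text \<open>A coordinate with modulus \<open>1\<close> is identically \<open>0\<close>, so the central coordinates form the product of
  the groups \<open>\<int>/p\<close> over \<open>p \<in> S\<close>.\<close>

definition central_extension :: "nat set \<Rightarrow> ((nat \<Rightarrow> int) \<times> (int_matrix \<times> int)) monoid"
  where "central_extension S =
    \<lparr>carrier = {c. \<forall>p. c p mod center_modulus S p = c p} \<times> carrier G_inf,
     monoid.mult = (\<lambda>(c, x) (d, y).
       (\<lambda>p. (c p + d p + cocycle x y p) mod center_modulus S p, x \<otimes>\<^bsub>G_inf\<^esub> y)),
     one = (\<lambda>p. 0, \<one>\<^bsub>G_inf\<^esub>)\<rparr>"

lemma central_extension_simps:
  "carrier (central_extension S) =
    {c. \<forall>p. c p mod center_modulus S p = c p} \<times> carrier G_inf"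
  "(c, x) \<otimes>\<^bsub>central_extension S\<^esub> (d, y) =
    (\<lambda>p. (c p + d p + cocycle x y p) mod center_modulus S p, x \<otimes>\<^bsub>G_inf\<^esub> y)"
  "\<one>\<^bsub>central_extension S\<^esub> = (\<lambda>p. 0, \<one>\<^bsub>G_inf\<^esub>)"
  by (simp_all add: central_extension_def)

lemma group_central_extension: "group (central_extension S)"
proof -
  interpret G: group G_inf by (rule group_G_inf)
  show ?thesis
  proof (rule groupI)
    fix u v w
    assume "u \<in> carrier (central_extension S)" "v \<in> carrier (central_extension S)"
      "w \<in> carrier (central_extension S)"
    then obtain c x d y e z where u: "u = (c, x)" "v = (d, y)" "w = (e, z)"
      "x \<in> carrier G_inf" "y \<in> carrier G_inf" "z \<in> carrier G_inf"
      by (auto simp: central_extension_simps)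
    have "((c p + d p + cocycle x y p) mod m + e p + cocycle (x \<otimes>\<^bsub>G_inf\<^esub> y) z p) mod m =
        (c p + (d p + e p + cocycle y z p) mod m + cocycle x (y \<otimes>\<^bsub>G_inf\<^esub> z) p) mod m" for p m
    proof -
      have "(c p + d p + cocycle x y p) + (e p + cocycle (x \<otimes>\<^bsub>G_inf\<^esub> y) z p) =
          (d p + e p + cocycle y z p) + (c p + cocycle x (y \<otimes>\<^bsub>G_inf\<^esub> z) p)"
        using cocycle_assoc[OF u(4,5,6), of p] by simp
      then have "((c p + d p + cocycle x y p) mod m + (e p + cocycle (x \<otimes>\<^bsub>G_inf\<^esub> y) z p)) mod m =
          ((d p + e p + cocycle y z p) mod m + (c p + cocycle x (y \<otimes>\<^bsub>G_inf\<^esub> z) p)) mod m"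
        by (simp only: mod_add_left_eq)
      then show ?thesis by (simp only: add.assoc add.commute add.left_commute)
    qed
    then show "u \<otimes>\<^bsub>central_extension S\<^esub> v \<otimes>\<^bsub>central_extension S\<^esub> w =
        u \<otimes>\<^bsub>central_extension S\<^esub> (v \<otimes>\<^bsub>central_extension S\<^esub> w)"
      using u by (simp add: central_extension_simps G.m_assoc)
  next
    fix u assume "u \<in> carrier (central_extension S)"
    then obtain c x where u: "u = (c, x)" "x \<in> carrier G_inf" by (auto simp: central_extension_simps)
    \<comment> \<open>The central part must compensate for the cocycle of the two mutually inverse
      elements.\<close>
    let ?v = "(\<lambda>p. (- c p - cocycle (inv\<^bsub>G_inf\<^esub> x) x p) mod center_modulus S p, inv\<^bsub>G_inf\<^esub> x)"
    have "((- c p - d) mod m + c p + d) mod m = 0" for p d m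
      by (simp only: add.assoc mod_add_left_eq) simp
    then have "?v \<otimes>\<^bsub>central_extension S\<^esub> u = \<one>\<^bsub>central_extension S\<^esub>"
      using u by (simp add: central_extension_simps)
    moreover have "?v \<in> carrier (central_extension S)"
      using u by (simp add: central_extension_simps)
    ultimately show "\<exists>v\<in>carrier (central_extension S).
        v \<otimes>\<^bsub>central_extension S\<^esub> u = \<one>\<^bsub>central_extension S\<^esub>" by blast
  qed (auto simp: central_extension_simps cocycle_one)
qed

lemma snd_central_extension_hom: "snd \<in> hom (central_extension S) G_inf"
  by (auto simp: hom_def central_extension_simps)

lemma central_extension_center:
  assumes "u \<in> carrier (central_extension S)" "v \<in> carrier (central_extension S)"
    "snd u = \<one>\<^bsub>G_inf\<^esub>"
  shows "u \<otimes>\<^bsub>central_extension S\<^esub> v = v \<otimes>\<^bsub>central_extension S\<^esub> u"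
proof -
  interpret G: group G_inf by (rule group_G_inf)
  show ?thesis using assms
    by (auto simp: central_extension_simps cocycle_one add.commute)
qed

section \<open>Two generators, and the finitely generated extension\<close>

lemma shift_matrices_one: "shift k \<one>\<^bsub>matrices\<^esub> = \<one>\<^bsub>matrices\<^esub>"
  by (simp add: shift_def matrices_one fun_eq_iff)

text \<open>Conjugating m_0 by the k-th power of \<phi> gives m_k, so both factors of the semidirect
  product are reached.\<close>

lemma generate_G_inf:
  "generate G_inf {(elem_matrix 0, 0), (\<one>\<^bsub>matrices\<^esub>, 1)} = carrier G_inf"
proof -
  interpret G: group G_inf by (rule group_G_inf)
  interpret M: group M_inf by (rule group_M_inf)
  have one: "\<one>\<^bsub>matrices\<^esub> \<in> carrier M_inf" using M.one_closed by (simp add: M_inf_one)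
  let ?g = "{(elem_matrix 0, 0), (\<one>\<^bsub>matrices\<^esub>, 1 :: int)}"
  let ?H = "generate G_inf ?g"
  have g: "?g \<subseteq> carrier G_inf" using one elem_matrix_in_M_inf by (simp add: G_inf_simps)
  have H: "subgroup ?H G_inf" by (rule G.generate_is_subgroup[OF g])
  have t: "(\<one>\<^bsub>matrices\<^esub>, k) \<otimes>\<^bsub>G_inf\<^esub> (\<one>\<^bsub>matrices\<^esub>, l) = (\<one>\<^bsub>matrices\<^esub>, k + l)" for k l
    by (simp add: G_inf_simps shift_matrices_one monoid.l_one[OF monoid_matrices]
        monoid.one_closed[OF monoid_matrices])
  have pos: "(\<one>\<^bsub>matrices\<^esub>, int m) \<in> ?H" for m
  proof (induction m)
    case 0
    then show ?case using subgroup.one_closed[OF H] by (simp add: G_inf_simps)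
  next
    case (Suc m)
    have "(\<one>\<^bsub>matrices\<^esub>, 1) \<in> ?H" by (rule generate.incl) simp
    then show ?case using t[of 1 "int m"] subgroup.m_closed[OF H _ Suc] by fastforce
  qed
  have phi: "(\<one>\<^bsub>matrices\<^esub>, k) \<in> ?H" for k
  proof (cases "0 \<le> k")
    case True
    then show ?thesis using pos[of "nat k"] by simp
  next
    case False
    then have "(\<one>\<^bsub>matrices\<^esub>, - k) \<in> ?H" using pos[of "nat (- k)"] by simp
    moreover have "inv\<^bsub>G_inf\<^esub> (\<one>\<^bsub>matrices\<^esub>, - k) = (\<one>\<^bsub>matrices\<^esub>, k)"
      by (rule G.inv_equality) (use t[of k "- k"] one in \<open>simp_all add: G_inf_simps\<close>)
    ultimately show ?thesis using subgroup.m_inv_closed[OF H] by fastforce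
  qed
  have elem: "(elem_matrix k, 0) \<in> ?H" for k
  proof -
    have "(elem_matrix 0, 0) \<in> ?H" by (rule generate.incl) simp
    then have "(\<one>\<^bsub>matrices\<^esub>, k) \<otimes>\<^bsub>G_inf\<^esub> (elem_matrix 0, 0) \<otimes>\<^bsub>G_inf\<^esub> (\<one>\<^bsub>matrices\<^esub>, - k) \<in> ?H"
      by (intro subgroup.m_closed[OF H] phi)
    moreover have "(\<one>\<^bsub>matrices\<^esub>, k) \<otimes>\<^bsub>G_inf\<^esub> (elem_matrix 0, 0) \<otimes>\<^bsub>G_inf\<^esub> (\<one>\<^bsub>matrices\<^esub>, - k) =
        (elem_matrix k, 0)"
      using M_inf_Units[OF elem_matrix_in_M_inf[of k]]
      by (simp add: G_inf_simps shift_elem_matrix shift_matrices_one Units_def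
          monoid.l_one[OF monoid_matrices] monoid.r_one[OF monoid_matrices])
    ultimately show ?thesis by simp
  qed
  have mat: "(A, 0) \<in> ?H" if "A \<in> carrier M_inf" for A
    using that unfolding M_inf_carrier
  proof (induction rule: generate.induct)
    case one
    then show ?case using subgroup.one_closed[OF H] by (simp add: G_inf_simps units_of_one)
  next
    case (incl A)
    then show ?case using elem by auto
  next
    case (inv A)
    then obtain k where k: "A = elem_matrix k" by auto
    have "inv\<^bsub>units_of matrices\<^esub> A = inv\<^bsub>M_inf\<^esub> A"
      using M_inf_inv[OF elem_matrix_in_M_inf] monoid.units_of_inv[OF monoid_matrices elem_matrix_Units] k
      by simp
    then have "(inv\<^bsub>units_of matrices\<^esub> A, 0) = inv\<^bsub>G_inf\<^esub> (A, 0)"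
      using G_inf_inv_matrix[OF elem_matrix_in_M_inf] k by simp
    then show ?case using subgroup.m_inv_closed[OF H] elem k by simp
  next
    case (eng A B)
    then show ?case using subgroup.m_closed[OF H eng.IH] by (simp add: G_inf_simps units_of_mult)
  qed
  have "(A, k) \<in> ?H" if "A \<in> carrier M_inf" for A k
  proof -
    have "(A, 0) \<otimes>\<^bsub>G_inf\<^esub> (\<one>\<^bsub>matrices\<^esub>, k) = (A, k)"
      using M_inf_Units[OF that] by (simp add: G_inf_simps Units_def monoid.r_one[OF monoid_matrices])
    then show ?thesis using subgroup.m_closed[OF H mat[OF that] phi[of k]] by simp
  qed
  then have "carrier G_inf \<subseteq> ?H" by (auto simp: G_inf_simps)
  then show ?thesis using G.generate_incl[OF g] by blast
qed

definition extension_generators :: "((nat \<Rightarrow> int) \<times> (int_matrix \<times> int)) set"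
  where "extension_generators = {(\<lambda>_. 0, (elem_matrix 0, 0)), (\<lambda>_. 0, (\<one>\<^bsub>matrices\<^esub>, 1))}"

definition fg_extension :: "nat set \<Rightarrow> ((nat \<Rightarrow> int) \<times> (int_matrix \<times> int)) monoid"
  where "fg_extension S = subgroup_generated (central_extension S) extension_generators"

lemma extension_generators_carrier: "extension_generators \<subseteq> carrier (central_extension S)"
  using elem_matrix_in_M_inf[of 0] monoid.one_closed[OF group.is_monoid[OF group_M_inf]]
  by (simp add: extension_generators_def central_extension_simps G_inf_simps M_inf_one)

lemma fg_extension_carrier:
  "carrier (fg_extension S) = generate (central_extension S) extension_generators"
  using extension_generators_carrier[of S]
  by (simp add: fg_extension_def carrier_subgroup_generated Int_absorb1)

lemma fg_extension_subset: "carrier (fg_extension S) \<subseteq> carrier (central_extension S)"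
  unfolding fg_extension_carrier
  by (rule group.generate_incl[OF group_central_extension extension_generators_carrier])

lemma fg_extension_simps:
  "x \<otimes>\<^bsub>fg_extension S\<^esub> y = x \<otimes>\<^bsub>central_extension S\<^esub> y"
  "\<one>\<^bsub>fg_extension S\<^esub> = \<one>\<^bsub>central_extension S\<^esub>"
  by (simp_all add: fg_extension_def)

lemma group_fg_extension: "group (fg_extension S)"
  unfolding fg_extension_def by (rule group.group_subgroup_generated[OF group_central_extension])

lemma finitely_generated_fg_extension: "finitely_generated (fg_extension S)"
  unfolding finitely_generated_def
proof (intro exI[of _ extension_generators] conjI)
  show "finite extension_generators" by (simp add: extension_generators_def)
  show sub: "extension_generators \<subseteq> carrier (fg_extension S)"
    unfolding fg_extension_carrier by (auto intro: generate.incl)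
  have "carrier (subgroup_generated (fg_extension S) extension_generators) = carrier (fg_extension S)"
    unfolding fg_extension_def by (simp add: group.subgroup_generated2[OF group_central_extension])
  then show "generate (fg_extension S) extension_generators = carrier (fg_extension S)"
    using sub by (simp add: carrier_subgroup_generated Int_absorb1)
qed

lemma snd_fg_extension_epi: "snd \<in> epi (fg_extension S) G_inf"
proof -
  interpret group_hom "central_extension S" G_inf snd
    using group_central_extension group_G_inf snd_central_extension_hom
    by (simp add: group_hom_def group_hom_axioms_def)
  have "snd ` carrier (fg_extension S) = generate G_inf (snd ` extension_generators)"
    unfolding fg_extension_carrier by (rule generate_img[OF extension_generators_carrier, symmetric])
  also have "\<dots> = carrier G_inf"
    using generate_G_inf by (simp add: extension_generators_def)
  finally have "snd ` carrier (fg_extension S) = carrier G_inf" .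
  moreover have "snd \<in> hom (fg_extension S) G_inf"
    using fg_extension_subset[of S] hom_closed hom_mult
    by (intro homI) (simp_all only: fg_extension_simps subset_iff)
  ultimately show ?thesis by (simp add: epi_def)
qed

section \<open>Prime torsion of the extension\<close>

definition has_element_of_order :: "('a, 'b) monoid_scheme \<Rightarrow> nat \<Rightarrow> bool"
  where "has_element_of_order G p \<longleftrightarrow> (\<exists>x\<in>carrier G. x \<noteq> \<one>\<^bsub>G\<^esub> \<and> x [^]\<^bsub>G\<^esub> p = \<one>\<^bsub>G\<^esub>)"

lemma central_pow:
  assumes "\<forall>q. c q mod center_modulus S q = c q"
  shows "(c, \<one>\<^bsub>G_inf\<^esub>) [^]\<^bsub>central_extension S\<^esub> (n::nat) =
    (\<lambda>q. int n * c q mod center_modulus S q, \<one>\<^bsub>G_inf\<^esub>)"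
proof -
  interpret G: group G_inf by (rule group_G_inf)
  show ?thesis
    by (induction n) (auto simp: central_extension_simps cocycle_one mod_simps algebra_simps)
qed

text \<open>Torsion elements lie in the kernel because \<open>G_inf\<close> is torsion-free; a
  non-zero coordinate q of one killed by p gives q dvd p, hence q = p. Conversely, lifts of m_p and
  m_0 have a commutator equal to the unit vector at p: its coordinate q is the antisymmetrised
  cocycle.\<close>

lemma has_element_of_order_fg_extension:
  assumes p: "Factorial_Ring.prime p" and S: "S \<subseteq> {p. Factorial_Ring.prime p}"
  shows "has_element_of_order (fg_extension S) p \<longleftrightarrow> p \<in> S"
proof -
  interpret E: group "central_extension S" by (rule group_central_extension)
  interpret F: group "fg_extension S" by (rule group_fg_extension)
  interpret G: group G_inf by (rule group_G_inf)
  interpret h: group_hom "fg_extension S" G_inf snd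
    using group_fg_extension group_G_inf snd_fg_extension_epi
    by (simp add: group_hom_def group_hom_axioms_def epi_def)
  have pow: "u [^]\<^bsub>fg_extension S\<^esub> n = u [^]\<^bsub>central_extension S\<^esub> n" for u and n :: nat
    unfolding fg_extension_def by (simp add: pow_subgroup_generated)
  have p0: "0 < p" using p by (rule prime_gt_0_nat)
  show ?thesis
  proof
    assume "has_element_of_order (fg_extension S) p"
    then obtain u where u: "u \<in> carrier (fg_extension S)" "u \<noteq> \<one>\<^bsub>fg_extension S\<^esub>"
      "u [^]\<^bsub>fg_extension S\<^esub> p = \<one>\<^bsub>fg_extension S\<^esub>"
      by (auto simp: has_element_of_order_def)
    have "snd u [^]\<^bsub>G_inf\<^esub> p = \<one>\<^bsub>G_inf\<^esub>"
      using u h.hom_nat_pow[of u p] h.hom_one by simp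
    then have "snd u = \<one>\<^bsub>G_inf\<^esub>" using G_inf_torsion_free[OF h.hom_closed[OF u(1)] p0] by simp
    then obtain c where c: "u = (c, \<one>\<^bsub>G_inf\<^esub>)" "\<forall>q. c q mod center_modulus S q = c q"
      using u fg_extension_subset[of S] by (cases u) (auto simp: central_extension_simps)
    have "(\<lambda>q. int p * c q mod center_modulus S q) = (\<lambda>q. 0)"
      using u(3) central_pow[OF c(2), of p] by (simp add: pow c(1) fg_extension_simps central_extension_simps)
    then have pc: "int p * c q mod center_modulus S q = 0" for q by (rule fun_cong)
    obtain q where q: "c q \<noteq> 0"
      using u(2) by (auto simp: c fg_extension_simps central_extension_simps)
    then have qS: "q \<in> S" using spec[OF c(2), of q] by (auto simp: center_modulus_def split: if_splits)
    then have "Factorial_Ring.prime q" using S by auto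
    have "int q dvd int p * c q" using pc[of q] qS by (auto simp: center_modulus_def)
    moreover have "\<not> int q dvd c q"
      using spec[OF c(2), of q] q qS by (auto simp: center_modulus_def)
    ultimately have "q dvd p"
      using \<open>Factorial_Ring.prime q\<close> by (simp add: prime_dvd_mult_iff)
    then show "p \<in> S" using p \<open>Factorial_Ring.prime q\<close> qS primes_dvd_imp_eq by blast
  next
    assume pS: "p \<in> S"
    have "(elem_matrix (int p), 0) \<in> snd ` carrier (fg_extension S)"
      using snd_fg_extension_epi[of S] elem_matrix_in_M_inf by (simp add: epi_def G_inf_simps)
    \<comment> \<open>The central part \<open>c\<close> of this lift is arbitrary; it cancels when
      uv is compared with vu.\<close>
    then obtain c where u: "(c, (elem_matrix (int p), 0)) \<in> carrier (fg_extension S)" by force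
    define u where "u = (c, (elem_matrix (int p), 0::int))"
    define v where "v = (\<lambda>_::nat. 0::int, (elem_matrix 0, 0::int))"
    have uv: "u \<in> carrier (fg_extension S)" "v \<in> carrier (fg_extension S)"
      using u generate.incl[of v extension_generators "central_extension S"]
      by (auto simp: u_def v_def fg_extension_carrier extension_generators_def)
    define z where "z = (\<lambda>q. (if q = p then 1 else 0) :: int, \<one>\<^bsub>G_inf\<^esub>)"
    have sd: "superdiag (elem_matrix k, 0) i = (if i = k then 1 else 0)" for k i
      by (auto simp: superdiag_def elem_matrix_def)
    have c1: "cocycle (elem_matrix (int p), 0) (elem_matrix 0, 0) q = (if q = p then 1 else 0)" for q
    proof -
      have "{i. (if i + int q = int p then 1 else 0 :: int) \<noteq> 0} = {int p - int q}" by auto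
      then show ?thesis by (simp add: cocycle_def pairing_def sd)
    qed
    have c2: "cocycle (elem_matrix 0, 0) (elem_matrix (int p), 0) q = 0" for q
    proof -
      have "{i. (if i + int q = 0 then 1 else 0 :: int) \<noteq> 0} = {- int q}" by auto
      then show ?thesis using p0 by (simp add: cocycle_def pairing_def sd)
    qed
    \<comment> \<open>The positions p and 0 are then not adjacent, so m_p and m_0 commute in
      \<open>G_inf\<close> and their lifts differ only by a central factor.\<close>
    have p2: "2 \<le> int p" using prime_ge_2_nat[OF p] by simp
    have com: "elem_matrix (int p) \<otimes>\<^bsub>matrices\<^esub> elem_matrix 0 =
        elem_matrix 0 \<otimes>\<^bsub>matrices\<^esub> elem_matrix (int p)"
      using p2 unfolding elem_matrix_eq
      by (auto simp: fun_eq_iff superdiag_matrix_mult) (auto simp: superdiag_matrix_def)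
    have zE: "z \<in> carrier (central_extension S)"
      using pS p2 by (auto simp: z_def central_extension_simps center_modulus_def)
    have xy: "(elem_matrix 0, 0) \<otimes>\<^bsub>G_inf\<^esub> (elem_matrix (int p), 0) \<in> carrier G_inf"
      using elem_matrix_in_M_inf by (intro G.m_closed) (auto simp: G_inf_simps)
    have "u \<otimes>\<^bsub>central_extension S\<^esub> v = z \<otimes>\<^bsub>central_extension S\<^esub> (v \<otimes>\<^bsub>central_extension S\<^esub> u)"
    proof -
      have "(elem_matrix (int p), 0) \<otimes>\<^bsub>G_inf\<^esub> (elem_matrix 0, 0) =
          (elem_matrix 0, 0) \<otimes>\<^bsub>G_inf\<^esub> (elem_matrix (int p), 0)"
        by (simp add: G_inf_simps com)
      then show ?thesis
        using xy unfolding u_def v_def z_def central_extension_simps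
        by (simp add: c1 c2 cocycle_one mod_simps add.commute)
    qed
    moreover have "u \<in> carrier (central_extension S)" "v \<in> carrier (central_extension S)"
      using uv fg_extension_subset[of S] by auto
    ultimately have "z = u \<otimes>\<^bsub>central_extension S\<^esub> v \<otimes>\<^bsub>central_extension S\<^esub>
        inv\<^bsub>central_extension S\<^esub> (v \<otimes>\<^bsub>central_extension S\<^esub> u)"
      using zE by (simp add: E.m_assoc)
    also have "\<dots> = u \<otimes>\<^bsub>fg_extension S\<^esub> v \<otimes>\<^bsub>fg_extension S\<^esub> inv\<^bsub>fg_extension S\<^esub> (v \<otimes>\<^bsub>fg_extension S\<^esub> u)"
      using E.inv_subgroup_generated[of "v \<otimes>\<^bsub>fg_extension S\<^esub> u" extension_generators]
        F.m_closed[OF uv(2,1)] by (simp add: fg_extension_def)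
    finally have "z \<in> carrier (fg_extension S)" using uv by simp
    moreover have "z \<noteq> \<one>\<^bsub>fg_extension S\<^esub>"
      by (auto simp: z_def fg_extension_simps central_extension_simps fun_eq_iff)
    moreover have "z [^]\<^bsub>fg_extension S\<^esub> p = \<one>\<^bsub>fg_extension S\<^esub>"
    proof -
      have "\<forall>q. (if q = p then 1 else 0) mod center_modulus S q = (if q = p then 1 else 0)"
        using zE by (simp add: z_def central_extension_simps)
      from central_pow[OF this, of p] show ?thesis
        using pS by (auto simp: pow z_def fg_extension_simps central_extension_simps center_modulus_def)
    qed
    ultimately show "has_element_of_order (fg_extension S) p"
      unfolding has_element_of_order_def by blast
  qed
qed

section \<open>Copies on the natural numbers\<close>

lemma (in group) word_eval_append:
  assumes "range x \<subseteq> carrier G"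
  shows "word_eval G x (u @ v) = word_eval G x u \<otimes> word_eval G x v"
proof -
  have x: "x i \<in> carrier G" for i using assms by auto
  have "word_eval G x w \<in> carrier G" for w using x by (intro word_eval_closed) auto
  then show ?thesis using x by (induction u) (auto simp: m_assoc)
qed

lemma (in group) countable_finitely_generated:
  assumes "finitely_generated G"
  shows "countable (carrier G)"
proof -
  obtain S where S: "finite S" "S \<subseteq> carrier G" "generate G S = carrier G"
    using assms by (auto simp: finitely_generated_def)
  \<comment> \<open>\<open>from_nat_into\<close> enumerates only non-empty sets, which the inserted
    unit guarantees even for empty S.\<close>
  define x where "x = from_nat_into (insert \<one> S)"
  have x: "range x \<subseteq> carrier G"
    using range_from_nat_into_subset[of "insert \<one> S"] S by (auto simp: x_def)
  have xs: "\<exists>i. x i = s" if "s \<in> S" for s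
    using from_nat_into_surj[of "insert \<one> S" s] S that by (auto simp: x_def countable_finite)
  have "g \<in> range (word_eval G x)" if "g \<in> generate G S" for g
    using that
  proof (induction rule: generate.induct)
    case one
    then show ?case by (intro range_eqI[of _ _ "[]"]) simp
  next
    case (incl s)
    then obtain i where "x i = s" using xs by blast
    then show ?case using incl S by (intro range_eqI[of _ _ "[(i, True)]"]) auto
  next
    case (inv s)
    then obtain i where "x i = s" using xs by blast
    then show ?case using inv S by (intro range_eqI[of _ _ "[(i, False)]"]) auto
  next
    case (eng g h)
    then obtain u v where "g = word_eval G x u" "h = word_eval G x v" by blast
    then have "g \<otimes> h = word_eval G x (u @ v)" using word_eval_append[OF x] by simp
    then show ?case by (rule range_eqI)
  qed
  then have "carrier G \<subseteq> range (word_eval G x)" using S by blast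
  then show ?thesis by (rule countable_subset) simp
qed

lemma has_element_of_order_iso:
  assumes G: "group G" and H: "group H" and iso: "G \<cong> H" and x: "has_element_of_order G p"
  shows "has_element_of_order H p"
proof -
  obtain h where h: "h \<in> iso G H" using iso by (auto simp: is_iso_def)
  then interpret group_hom G H h
    using G H by (simp add: group_hom_def group_hom_axioms_def iso_iff)
  obtain y where y: "y \<in> carrier G" "y \<noteq> \<one>\<^bsub>G\<^esub>" "y [^]\<^bsub>G\<^esub> p = \<one>\<^bsub>G\<^esub>"
    using x by (auto simp: has_element_of_order_def)
  have inj: "inj_on h (carrier G)" using h by (simp add: iso_def bij_betw_def)
  have "h y \<noteq> \<one>\<^bsub>H\<^esub>"
    using inj_onD[OF inj, of y "\<one>\<^bsub>G\<^esub>"] y(1,2) hom_one by auto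
  moreover have "h y [^]\<^bsub>H\<^esub> p = \<one>\<^bsub>H\<^esub>" using hom_nat_pow[OF y(1), of p] y(3) hom_one by simp
  ultimately show ?thesis unfolding has_element_of_order_def using hom_closed[OF y(1)] by blast
qed

text \<open>Depth, absence of identities and amenability are obtained for K directly from the
  composite map onto \<open>G_inf\<close>. Only finite generation, centrality of the kernel and
  torsion are carried over along the isomorphism.\<close>

lemma nat_copy:
  assumes S: "S \<subseteq> {p. Factorial_Ring.prime p}"
  shows "\<exists>K :: nat monoid. group K \<and> finitely_generated K \<and> elementary_amenable K \<and> fractal K \<and>
    (\<forall>n w. 1 \<le> n \<and> w \<in> carrier (free_group n) \<and> w \<noteq> \<one>\<^bsub>free_group n\<^esub> \<longrightarrow>
      \<not> satisfies_identity K n w) \<and>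
    (\<forall>p. Factorial_Ring.prime p \<longrightarrow> (has_element_of_order K p \<longleftrightarrow> p \<in> S))"
proof -
  interpret F: group "fg_extension S" by (rule group_fg_extension)
  have "countable (carrier (fg_extension S))"
    by (rule F.countable_finitely_generated[OF finitely_generated_fg_extension])
  then obtain f :: "_ \<Rightarrow> nat" where f: "inj_on f (carrier (fg_extension S))"
    by (auto simp: countable_def)
  define K where "K = image_group f (fg_extension S)"
  have iso: "f \<in> iso (fg_extension S) K" and K: "group K"
    unfolding K_def using f by (rule inj_imp_image_group_iso, rule F.inj_imp_image_group_is_group)
  interpret f: group_hom "fg_extension S" K f
    using iso K by (simp add: group_hom_def group_hom_axioms_def iso_iff F.is_group)
  define g where "g = inv_into (carrier (fg_extension S)) f"
  have g: "g \<in> iso K (fg_extension S)" unfolding g_def by (rule F.iso_set_sym[OF iso])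
  have h: "snd \<circ> g \<in> epi K G_inf"
  proof -
    have "snd \<in> hom (fg_extension S) G_inf" "snd ` carrier (fg_extension S) = carrier G_inf"
      using snd_fg_extension_epi[of S] by (auto simp: epi_def)
    moreover have "g \<in> hom K (fg_extension S)" "g ` carrier K = carrier (fg_extension S)"
      using g by (auto simp: iso_def bij_betw_def)
    ultimately have "snd \<circ> g \<in> hom K G_inf" "(snd \<circ> g) ` carrier K = carrier G_inf"
      by (auto intro: hom_compose simp only: image_comp[symmetric])
    then show ?thesis by (simp only: epi_def mem_Collect_eq simp_thms)
  qed
  then have hom: "snd \<circ> g \<in> hom K G_inf" by (simp add: epi_def)
  have central: "x \<otimes>\<^bsub>K\<^esub> y = y \<otimes>\<^bsub>K\<^esub> x"
    if "x \<in> carrier K" "y \<in> carrier K" "(snd \<circ> g) x = \<one>\<^bsub>G_inf\<^esub>" for x y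
  proof -
    have gc: "g x \<in> carrier (fg_extension S)" "g y \<in> carrier (fg_extension S)"
      using g that by (auto simp: iso_def hom_def)
    then have "g x \<otimes>\<^bsub>fg_extension S\<^esub> g y = g y \<otimes>\<^bsub>fg_extension S\<^esub> g x"
      using central_extension_center[of "g x" S "g y"] fg_extension_subset[of S] that
      by (auto simp: fg_extension_simps)
    then have "f (g x) \<otimes>\<^bsub>K\<^esub> f (g y) = f (g y) \<otimes>\<^bsub>K\<^esub> f (g x)"
      using f.hom_mult gc by metis
    moreover have "f (g x) = x" "f (g y) = y"
      using that iso by (auto simp: g_def iso_iff intro!: f_inv_into_f)
    ultimately show ?thesis by simp
  qed
  have "finitely_generated K"
  proof -
    obtain T where T: "finite T" "T \<subseteq> carrier (fg_extension S)"
      "generate (fg_extension S) T = carrier (fg_extension S)"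
      using finitely_generated_fg_extension[of S] unfolding finitely_generated_def by blast
    have "generate K (f ` T) = carrier K"
      using f.generate_img[OF T(2)] T(3) iso by (simp add: iso_iff)
    then show ?thesis using T unfolding finitely_generated_def
      by (intro exI[of _ "f ` T"]) auto
  qed
  moreover have "elementary_amenable K"
    using central by (rule elementary_amenable_over_G_inf[OF K hom])
  moreover have "fractal K"
    by (rule fractalI[OF K h central_extension_satisfies_w_bar[OF K hom central]])
  moreover have "has_element_of_order K p \<longleftrightarrow> p \<in> S" if "Factorial_Ring.prime p" for p
    using has_element_of_order_iso[OF F.is_group K is_isoI[OF iso]]
      has_element_of_order_iso[OF K F.is_group is_isoI[OF g]]
      has_element_of_order_fg_extension[OF that S] by blast
  ultimately show ?thesis using K no_identity[OF K h] by (auto simp: free_group_one)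
qed

lemma Pow_primes_eqpoll_real: "Pow {p::nat. Factorial_Ring.prime p} \<approx> (UNIV :: real set)"
proof -
  have "\<exists>f. bij_betw f {p::nat. Factorial_Ring.prime p} (UNIV :: nat set)"
    using to_nat_on_infinite[of "{p::nat. Factorial_Ring.prime p}"] primes_infinite by blast
  then obtain f where "bij_betw f {p::nat. Factorial_Ring.prime p} (UNIV :: nat set)" ..
  then have "bij_betw (image f) (Pow {p::nat. Factorial_Ring.prime p}) (Pow UNIV)" by (rule bij_betw_Pow)
  then have "Pow {p::nat. Factorial_Ring.prime p} \<approx> (UNIV :: nat set set)" by (auto simp: eqpoll_def)
  then show ?thesis using nat_sets_eqpoll_reals eqpoll_trans by blast
qed

theorem mainTheorem6:
  shows "(satisfies_iterated_identity G_inf 3 w_bar \<and>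
      (\<forall>n w. 1 \<le> n \<and> w \<in> carrier (free_group n) \<and> w \<noteq> \<one>\<^bsub>free_group n\<^esub> \<and>
          satisfies_iterated_identity G_inf n w \<longrightarrow> word_depth G_inf n w = \<infinity>) \<and>
      fractal G_inf) \<and>
    (\<exists>\<G> :: nat monoid set.
      \<G> \<approx> (UNIV :: real set) \<and>
      pairwise (\<lambda>G H. \<not> G \<cong> H) \<G> \<and>
      (\<forall>G\<in>\<G>. group G \<and> finitely_generated G \<and> elementary_amenable G \<and> fractal G \<and>
        (\<forall>n w. 1 \<le> n \<and> w \<in> carrier (free_group n) \<and> w \<noteq> \<one>\<^bsub>free_group n\<^esub> \<longrightarrow>
          \<not> satisfies_identity G n w)))"
proof (intro conjI)
  have id: "id \<in> epi G_inf G_inf" by (simp add: epi_def hom_def)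
  show "satisfies_iterated_identity G_inf 3 w_bar" by (rule G_inf_satisfies_w_bar)
  show "\<forall>n w. 1 \<le> n \<and> w \<in> carrier (free_group n) \<and> w \<noteq> \<one>\<^bsub>free_group n\<^esub> \<and>
      satisfies_iterated_identity G_inf n w \<longrightarrow> word_depth G_inf n w = \<infinity>"
    using word_depth_infinite[OF group_G_inf id] by (simp add: free_group_one)
  show "fractal G_inf" by (rule fractalI[OF group_G_inf id G_inf_satisfies_w_bar])
  let ?good = "\<lambda>G :: nat monoid. group G \<and> finitely_generated G \<and> elementary_amenable G \<and> fractal G \<and>
    (\<forall>n w. 1 \<le> n \<and> w \<in> carrier (free_group n) \<and> w \<noteq> \<one>\<^bsub>free_group n\<^esub> \<longrightarrow>
      \<not> satisfies_identity G n w)"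
  have "\<forall>S\<in>Pow {p. Factorial_Ring.prime p}. \<exists>G. ?good G \<and>
      (\<forall>p. Factorial_Ring.prime p \<longrightarrow> (has_element_of_order G p \<longleftrightarrow> p \<in> S))"
  proof
    fix S :: "nat set" assume "S \<in> Pow {p. Factorial_Ring.prime p}"
    then have S: "S \<subseteq> {p. Factorial_Ring.prime p}" by blast
    show "\<exists>G. ?good G \<and>
        (\<forall>p. Factorial_Ring.prime p \<longrightarrow> (has_element_of_order G p \<longleftrightarrow> p \<in> S))"
      using nat_copy[OF S] unfolding conj_assoc .
  qed
  from bchoice[OF this] obtain K where K: "\<forall>S\<in>Pow {p. Factorial_Ring.prime p}. ?good (K S) \<and>
      (\<forall>p. Factorial_Ring.prime p \<longrightarrow> (has_element_of_order (K S) p \<longleftrightarrow> p \<in> S))" ..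
  have neq: "S = T" if ST: "S \<in> Pow {p. Factorial_Ring.prime p}" "T \<in> Pow {p. Factorial_Ring.prime p}"
    and iso: "K S \<cong> K T" for S T
  proof -
    have gr: "group (K S)" "group (K T)" using bspec[OF K ST(1)] bspec[OF K ST(2)] by blast+
    have "p \<in> S \<longleftrightarrow> p \<in> T" if p: "Factorial_Ring.prime p" for p
      using has_element_of_order_iso[OF gr iso, of p]
        has_element_of_order_iso[OF gr(2,1) group.iso_sym[OF gr(1) iso], of p]
        bspec[OF K ST(1)] bspec[OF K ST(2)] p by blast
    then show "S = T" using ST by blast
  qed
  \<comment> \<open>Isomorphic values have equal indices, so in particular equal values do, and the
    family is as large as its index set.\<close>
  then have "inj_on K (Pow {p. Factorial_Ring.prime p})"
    by (intro inj_onI) (metis iso_refl)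
  then have "K ` Pow {p. Factorial_Ring.prime p} \<approx> (UNIV :: real set)"
    using inj_on_image_eqpoll_self Pow_primes_eqpoll_real eqpoll_trans by blast
  moreover have "pairwise (\<lambda>G H. \<not> G \<cong> H) (K ` Pow {p. Factorial_Ring.prime p})"
    using neq by (auto simp: pairwise_def)
  ultimately show "\<exists>\<G> :: nat monoid set. \<G> \<approx> (UNIV :: real set) \<and> pairwise (\<lambda>G H. \<not> G \<cong> H) \<G> \<and>
      (\<forall>G\<in>\<G>. ?good G)"
    using K by (intro exI[of _ "K ` Pow {p. Factorial_Ring.prime p}"] conjI) auto
qed

end
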